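(* Let $p=(p_0,p_1,p_2,\ldots)$ be a probability distribution on $\mathbb{N}=\{0,1,2,\ldots\}$ that is sub-critical (i.e. $\mu_p=\sum_{k}kp_k<1$) and unbounded (i.e. the set $\{n;\,p_n>0\}$ is unbounded). Let $\tau$ be a Galton-Watson tree with offspring distribution $p$, let $M(\tau)$ be its maximal out-degree, and let $\tau^*(p)$ be the size-biased tree (condensation tree) associated with $p$. Then, with convergence in distribution understood for the local topology on trees (allowing nodes of infinite out-degree), as $n\to\infty$ along the infinite subsequence $\{n;\,p_n>0\}$, $$\mathrm{dist}\,(\tau \mid M(\tau)=n)\longrightarrow \mathrm{dist}\,(\tau^*(p)),$$ and, as $n\to\infty$, $$\mathrm{dist}\,(\tau \mid M(\tau)>n)\longrightarrow \mathrm{dist}\,(\tau^*(p)).$$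
   Context: Trees. Let $\mathbb{N}^*=\{1,2,\ldots\}$ and $\mathcal{U}=\bigcup_{n\ge 0}(\mathbb{N}^* )^n$ be the set of finite sequences of positive integers, with $(\mathbb{N}^* )^0=\{\emptyset\}$; $uv$ denotes concatenation. The set of ancestors of $u\in\mathcal{U}$ is $A_u=\{v\in\mathcal{U}:\ u=vw \text{ for some } w\in\mathcal{U},\ w\neq\emptyset\}$. A tree $\mathbf{t}$ is a subset of $\mathcal{U}$ such that: $\emptyset\in\mathbf{t}$; if $u\in\mathbf{t}$ then $A_u\subset\mathbf{t}$; for every $u\in\mathbf{t}$ there is $k_u(\mathbf{t})\in\mathbb{N}\cup\{+\infty\}$ (the out-degree, or number of offspring, of $u$) such that for every positive integer $i$, $ui\in\mathbf{t}$ iff $1\le i\le k_u(\mathbf{t})$. The root is $\emptyset$. The set of all trees is $\mathbb{T}_\infty$; $\mathbb{T}$ is the subset of trees all of whose out-degrees are finite. The maximal out-degree is $M(\mathbf{t})=\sup\{k_u(\mathbf{t});\,u\in\mathbf{t}\}$. Local topology. For $u=(u_1,\ldots,u_n)\in\mathcal{U}$ put $|u|_\infty=\max\{n,u_1,\ldots,u_n\}$ (with $|\emptyset|_\infty=0$), and for $h\in\mathbb{N}$ let $r_h(\mathbf{t})=\{u\in\mathbf{t}:\ |u|_\infty\le h\}$. The local topology on $\mathbb{T}_\infty$ is induced by the distance $d_\infty(\mathbf{t},\mathbf{t}')=2^{-\sup\{h\in\mathbb{N}:\ r_h(\mathbf{t})=r_h(\mathbf{t}')\}}$ (with $2^{-\infty}=0$).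 Convergence of distributions of random trees means weak convergence of probability measures for this topology. Galton-Watson tree. A $\mathbb{T}$-valued random variable $\tau$ is a Galton-Watson tree with offspring distribution $p$ if $k_\emptyset(\tau)$ has distribution $p$ and, for every $n\in\mathbb{N}^*$, conditionally on $\{k_\emptyset(\tau)=n\}$, the subtrees $\mathcal{S}_i(\tau)=\{v\in\mathcal{U}:\ iv\in\tau\}$, $1\le i\le n$, are independent and distributed as $\tau$. $\mathrm{dist}(\tau\mid A)$ denotes the conditional distribution of $\tau$ given the event $A$. The tree $\tau^*(p)$ for $p$ with $0<\mu_p\le 1$. It is the random tree built as follows. (i) Nodes are of two types, normal and special. (ii) The root is special. (iii) Normal nodes have offspring distribution $p$. (iv) Special nodes have offspring distribution $\tilde p$ on $\mathbb{N}\cup\{+\infty\}$ given by $\tilde p_k=kp_k$ for $k\in\mathbb{N}$ and $\tilde p_{+\infty}=1-\mu_p$. (v) The offspring numbers of all nodes are independent of each other. (vi) All children of a normal node are normal. (vii) When a special node has a finite number of children, one of them is selected uniformly at random and is special, while the others are normal. (viii) When a special node has infinitely many children, all of them are normal. When $\mu_p<1$, $\tau^*(p)$ is called the condensation tree. *)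

theory Defs
  imports "HOL-Probability.Probability"
begin

definition words :: "nat list set" where
  "words = {u. \<forall>i\<in>set u. 1 \<le> i}"

definition ancestors :: "nat list \<Rightarrow> nat list set" where
  "ancestors u = {v \<in> words. \<exists>w\<in>words. w \<noteq> [] \<and> u = v @ w}"

definition is_tree :: "nat list set \<Rightarrow> bool" where
  "is_tree t \<longleftrightarrow>
     t \<subseteq> words \<and> [] \<in> t \<and> (\<forall>u\<in>t. ancestors u \<subseteq> t) \<and>
     (\<forall>u\<in>t. \<exists>k::enat. \<forall>i\<ge>1. u @ [i] \<in> t \<longleftrightarrow> enat i \<le> k)"

typedef ulam_tree = "{t. is_tree t}" morphisms nodes Tree
proof
  show "{[]} \<in> {t. is_tree t}"
    by (auto simp: is_tree_def words_def ancestors_def intro!: exI[of _ 0] simp: zero_enat_def)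
qed

text \<open>If \<open>u\<close> is not a node of \<open>t\<close>, the unique \<open>k\<close> is \<open>0\<close>.\<close>

lemma ex1_outdegree: "\<exists>!k::enat. \<forall>i\<ge>1. u @ [i] \<in> nodes t \<longleftrightarrow> enat i \<le> k"
proof (rule ex_ex1I)
  have t: "is_tree (nodes t)" using nodes[of t] by simp
  show "\<exists>k::enat. \<forall>i\<ge>1. u @ [i] \<in> nodes t \<longleftrightarrow> enat i \<le> k"
  proof (cases "u \<in> nodes t")
    case True
    then show ?thesis using t unfolding is_tree_def by blast
  next
    case False
    have "u @ [i] \<notin> nodes t" for i
    proof
      assume *: "u @ [i] \<in> nodes t"
      then have "u \<in> ancestors (u @ [i])"
        using t by (auto simp: ancestors_def is_tree_def words_def)
      then show False using * False t by (auto simp: is_tree_def)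
    qed
    then show ?thesis by (intro exI[of _ 0]) (auto simp: zero_enat_def)
  qed
next
  fix k k' :: enat
  assume "\<forall>i\<ge>1. u @ [i] \<in> nodes t \<longleftrightarrow> enat i \<le> k" "\<forall>i\<ge>1. u @ [i] \<in> nodes t \<longleftrightarrow> enat i \<le> k'"
  then have *: "enat i \<le> k \<longleftrightarrow> enat i \<le> k'" if "i \<ge> 1" for i using that by blast
  have "k \<le> k'" if "\<And>i. i \<ge> 1 \<Longrightarrow> enat i \<le> k \<Longrightarrow> enat i \<le> k'" for k k' :: enat
  proof (rule ccontr)
    assume "\<not> k \<le> k'"
    then obtain n where n: "k' = enat n" "enat (Suc n) \<le> k"
      by (cases k') (auto simp: Suc_ile_eq)
    then show False using that[of "Suc n"] by simp
  qed
  then show "k = k'" using * by (intro antisym) blast+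
qed

definition outdegree :: "ulam_tree \<Rightarrow> nat list \<Rightarrow> enat" where
  "outdegree t u = (THE k. \<forall>i\<ge>1. u @ [i] \<in> nodes t \<longleftrightarrow> enat i \<le> k)"

definition max_outdegree :: "ulam_tree \<Rightarrow> enat" where
  "max_outdegree t = (SUP u\<in>nodes t. outdegree t u)"

definition locally_finite :: "ulam_tree set" where
  "locally_finite = {t. \<forall>u\<in>nodes t. outdegree t u \<noteq> \<infinity>}"

text \<open>The subtree above the \<open>i\<close>-th child of the root. If the root has no \<open>i\<close>-th child, the value
  is set to the tree consisting of the root only; this case is null under the conditioning used below.\<close>

definition subtree_at :: "nat \<Rightarrow> ulam_tree \<Rightarrow> ulam_tree" where
  "subtree_at i t = (if [i] \<in> nodes t then Tree {v. i # v \<in> nodes t} else Tree {[]})"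

lemma is_tree_subtree_at:
  assumes "[i] \<in> nodes t"
  shows "is_tree {v. i # v \<in> nodes t}"
proof -
  have t: "is_tree (nodes t)" using nodes[of t] by simp
  show ?thesis
    unfolding is_tree_def
  proof (intro conjI ballI)
    show "{v. i # v \<in> nodes t} \<subseteq> words"
      using t by (auto simp: is_tree_def words_def)
    show "[] \<in> {v. i # v \<in> nodes t}" using assms by simp
  next
    fix u assume u: "u \<in> {v. i # v \<in> nodes t}"
    show "ancestors u \<subseteq> {v. i # v \<in> nodes t}"
    proof
      fix v assume v: "v \<in> ancestors u"
      have "i # v \<in> ancestors (i # u)"
        using v u t by (auto simp: ancestors_def words_def is_tree_def)
      then show "v \<in> {v. i # v \<in> nodes t}"
        using u t by (auto simp: is_tree_def)
    qed
  next
    fix u assume "u \<in> {v. i # v \<in> nodes t}"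
    then have "\<exists>k::enat. \<forall>j\<ge>1. (i # u) @ [j] \<in> nodes t \<longleftrightarrow> enat j \<le> k"
      using t unfolding is_tree_def by blast
    then show "\<exists>k::enat. \<forall>j\<ge>1. u @ [j] \<in> {v. i # v \<in> nodes t} \<longleftrightarrow> enat j \<le> k"
      by simp
  qed
qed

definition word_norm :: "nat list \<Rightarrow> nat" where
  "word_norm u = Max (insert (length u) (set u))"

definition restr :: "nat \<Rightarrow> ulam_tree \<Rightarrow> nat list set" where
  "restr h t = {u \<in> nodes t. word_norm u \<le> h}"

definition agreement :: "ulam_tree \<Rightarrow> ulam_tree \<Rightarrow> enat" where
  "agreement t t' = (SUP h\<in>{h. restr h t = restr h t'}. enat h)"

lemma restr_mono_eq:
  assumes "restr h t = restr h t'" "g \<le> h"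
  shows "restr g t = restr g t'"
proof -
  have "restr g s = {u \<in> restr h s. word_norm u \<le> g}" for s
    using assms(2) by (auto simp: restr_def)
  then show ?thesis using assms(1) by simp
qed

lemma restr_0: "restr 0 t = {[]}"
proof -
  have "word_norm u \<le> 0 \<longleftrightarrow> u = []" for u
    unfolding word_norm_def by (subst Max_le_iff) auto
  moreover have "[] \<in> nodes t" using nodes[of t] by (simp add: is_tree_def)
  ultimately show ?thesis by (auto simp: restr_def)
qed

lemma le_agreement_iff: "enat h \<le> agreement t t' \<longleftrightarrow> restr h t = restr h t'"
proof
  assume "restr h t = restr h t'"
  then show "enat h \<le> agreement t t'"
    unfolding agreement_def by (intro SUP_upper) simp
next
  assume le: "enat h \<le> agreement t t'"
  show "restr h t = restr h t'"
  proof (cases h)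
    case 0
    then show ?thesis by (simp add: restr_0)
  next
    case (Suc g)
    then have "enat g < agreement t t'"
      using le by (metis Suc_ile_eq)
    then obtain k where "restr k t = restr k t'" "g < k"
      unfolding agreement_def less_SUP_iff by auto
    then show ?thesis using Suc restr_mono_eq[of k t t' h] by simp
  qed
qed

lemma agreement_infinity_iff: "agreement t t' = \<infinity> \<longleftrightarrow> t = t'"
proof
  assume inf: "agreement t t' = \<infinity>"
  have *: "restr h t = restr h t'" for h
    using inf le_agreement_iff[of h t t'] by simp
  have "u \<in> nodes t \<longleftrightarrow> u \<in> nodes t'" for u
    using *[of "word_norm u"] by (auto simp: restr_def set_eq_iff)
  then show "t = t'" by (auto simp: nodes_inject[symmetric])
next
  assume "t = t'"
  then have "enat h \<le> agreement t t'" for h by (simp add: le_agreement_iff)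
  then show "agreement t t' = \<infinity>"
    by (metis enat_ord_simps(1) not_enat_eq not_less_eq_eq order_refl)
qed

lemma agreement_commute: "agreement t t' = agreement t' t"
  unfolding agreement_def by (simp add: eq_commute)

lemma agreement_ultra: "min (agreement r s) (agreement s t) \<le> agreement r t"
proof (rule ccontr)
  assume "\<not> ?thesis"
  then have lt: "agreement r t < min (agreement r s) (agreement s t)" by (simp only: not_le)
  then obtain n where n: "agreement r t = enat n" by (cases "agreement r t") auto
  have "enat (Suc n) \<le> min (agreement r s) (agreement s t)"
    using lt n by (simp add: Suc_ile_eq)
  then have "enat (Suc n) \<le> agreement r s" "enat (Suc n) \<le> agreement s t"
    by (simp_all add: min_def split: if_splits)
  then have "enat (Suc n) \<le> agreement r t"
    by (simp add: le_agreement_iff)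
  then show False using n by simp
qed

instantiation ulam_tree :: metric_space
begin

definition dist_ulam_tree :: "ulam_tree \<Rightarrow> ulam_tree \<Rightarrow> real" where
  "dist_ulam_tree t t' = (case agreement t t' of enat n \<Rightarrow> (1/2) ^ n | \<infinity> \<Rightarrow> 0)"

definition uniformity_ulam_tree :: "(ulam_tree \<times> ulam_tree) filter" where
  "uniformity_ulam_tree = (INF e\<in>{0<..}. principal {(x, y). dist x y < e})"

definition open_ulam_tree :: "ulam_tree set \<Rightarrow> bool" where
  "open_ulam_tree U = (\<forall>x\<in>U. \<forall>\<^sub>F (x', y) in uniformity. x' = x \<longrightarrow> y \<in> U)"

instance
proof
  fix x y z :: ulam_tree
  show "dist x y = 0 \<longleftrightarrow> x = y"
    by (auto simp: dist_ulam_tree_def agreement_infinity_iff[symmetric] split: enat.splits)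
  define g where "g = (\<lambda>k. case k of enat n \<Rightarrow> (1/2::real) ^ n | \<infinity> \<Rightarrow> 0)"
  have anti: "g k \<le> g j" if "j \<le> k" for j k
    using that by (auto simp: g_def power_decreasing split: enat.splits)
  have nn: "0 \<le> g k" for k by (auto simp: g_def split: enat.splits)
  have d: "dist a b = g (agreement a b)" for a b :: ulam_tree
    by (simp add: dist_ulam_tree_def g_def)
  have "g (agreement x y) \<le> g (min (agreement x z) (agreement z y))"
    by (rule anti[OF agreement_ultra])
  also have "\<dots> \<le> g (agreement x z) + g (agreement z y)"
    using nn by (auto simp: min_def)
  finally show "dist x y \<le> dist x z + dist y z"
    by (simp add: d agreement_commute[of z y])
qed (simp_all add: uniformity_ulam_tree_def open_ulam_tree_def)

end

definition cond_dist :: "'a measure \<Rightarrow> ('a \<Rightarrow> ulam_tree) \<Rightarrow> 'a set \<Rightarrow> ulam_tree measure" where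
  "cond_dist M X A = distr (uniform_measure M A) borel X"

text \<open>Weak convergence of Borel probability measures along a filter. The requirement that
  all measures involved are (eventually) probability measures makes explicit that the
  distributions, in particular the conditional ones, are well-defined.\<close>

definition weakly_converges ::
    "('i \<Rightarrow> 'b::metric_space measure) \<Rightarrow> 'b measure \<Rightarrow> 'i filter \<Rightarrow> bool" where
  "weakly_converges N L F \<longleftrightarrow>
     (\<forall>\<^sub>F i in F. prob_space (N i) \<and> sets (N i) = sets borel) \<and>
     prob_space L \<and> sets L = sets borel \<and>
     (\<forall>f::'b \<Rightarrow> real. continuous_on UNIV f \<and> bounded (range f) \<longrightarrow>
        ((\<lambda>i. \<integral>x. f x \<partial>N i) \<longlongrightarrow> (\<integral>x. f x \<partial>L)) F)"

text \<open>The mean is a sum of extended nonnegative reals, so that it is \<open>\<infinity>\<close> if the series diverges.\<close>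

definition offspring_mean :: "nat pmf \<Rightarrow> ennreal" where
  "offspring_mean p = (\<Sum>k. of_nat k * ennreal (pmf p k))"

definition galton_watson :: "'a measure \<Rightarrow> ('a \<Rightarrow> ulam_tree) \<Rightarrow> nat pmf \<Rightarrow> bool" where
  "galton_watson M \<tau> p \<longleftrightarrow>
     prob_space M \<and> \<tau> \<in> M \<rightarrow>\<^sub>M borel \<and> (\<forall>\<omega>\<in>space M. \<tau> \<omega> \<in> locally_finite) \<and>
     distr M (count_space UNIV) (\<lambda>\<omega>. outdegree (\<tau> \<omega>) []) = measure_pmf (map_pmf enat p) \<and>
     (\<forall>n\<ge>1. pmf p n > 0 \<longrightarrow>
        (let Q = uniform_measure M {\<omega>\<in>space M. outdegree (\<tau> \<omega>) [] = enat n} in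
           prob_space.indep_vars Q (\<lambda>_. borel) (\<lambda>i \<omega>. subtree_at i (\<tau> \<omega>)) {1..n} \<and>
           (\<forall>i\<in>{1..n}. distr Q borel (\<lambda>\<omega>. subtree_at i (\<tau> \<omega>)) = distr M borel \<tau>)))"

text \<open>For \<open>0 < \<mu>\<^sub>p \<le> 1\<close> the weights are nonnegative and sum to \<open>1\<close>; otherwise the value of
  this definition is irrelevant.\<close>

definition special_offspring_pmf :: "nat pmf \<Rightarrow> enat pmf" where
  "special_offspring_pmf p = embed_pmf (\<lambda>k. case k of
       enat n \<Rightarrow> real n * pmf p n
     | \<infinity> \<Rightarrow> 1 - enn2real (offspring_mean p))"

text \<open>Number of children of a special node together with its special child, chosen uniformly. If
  there are infinitely many children, the second component is a dummy. The case of no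
  children has probability \<open>0\<close>.\<close>

definition special_pmf :: "nat pmf \<Rightarrow> (enat \<times> nat) pmf" where
  "special_pmf p = bind_pmf (special_offspring_pmf p) (\<lambda>k. case k of
       enat n \<Rightarrow> map_pmf (\<lambda>j. (enat n, j)) (pmf_of_set {1..n})
     | \<infinity> \<Rightarrow> return_pmf (\<infinity>, 0))"

text \<open>A label \<open>(m, k, j)\<close> of a word \<open>u\<close> means: if \<open>u\<close> turns out to be a normal node, it has \<open>m\<close>
  children; if it turns out to be a special node, it has \<open>k\<close> children, of which, if \<open>k\<close> is finite,
  the \<open>j\<close>-th one is special.\<close>

type_synonym labelling = "nat list \<Rightarrow> nat \<times> enat \<times> nat"

inductive special :: "labelling \<Rightarrow> nat list \<Rightarrow> bool" for l :: labelling where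
  special_root: "special l []"
| special_child: "special l u \<Longrightarrow> l u = (m, enat k, j) \<Longrightarrow> special l (u @ [j])"

definition offspring :: "labelling \<Rightarrow> nat list \<Rightarrow> enat" where
  "offspring l u = (case l u of (m, k, j) \<Rightarrow> if special l u then k else enat m)"

inductive_set grown_nodes :: "labelling \<Rightarrow> nat list set" for l :: labelling where
  grown_root: "[] \<in> grown_nodes l"
| grown_child: "u \<in> grown_nodes l \<Longrightarrow> 1 \<le> i \<Longrightarrow> enat i \<le> offspring l u \<Longrightarrow> u @ [i] \<in> grown_nodes l"

lemma grown_nodes_snoc:
  "u @ [i] \<in> grown_nodes l \<longleftrightarrow> u \<in> grown_nodes l \<and> 1 \<le> i \<and> enat i \<le> offspring l u"
  by (auto elim: grown_nodes.cases intro: grown_nodes.intros)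

lemma is_tree_grown_nodes: "is_tree (grown_nodes l)"
proof -
  have prefix: "v @ w \<in> grown_nodes l \<Longrightarrow> v \<in> grown_nodes l" for v w
    by (induction w rule: rev_induct)
      (auto simp: grown_nodes_snoc simp flip: append_assoc)
  have "u \<in> words" if "u \<in> grown_nodes l" for u
    using that by induction (auto simp: words_def)
  then show ?thesis
    using prefix
    by (auto simp: is_tree_def ancestors_def grown_nodes_snoc intro: grown_root)
qed

definition grown_tree :: "labelling \<Rightarrow> ulam_tree" where
  "grown_tree l = Tree (grown_nodes l)"

definition size_biased_tree :: "nat pmf \<Rightarrow> ulam_tree measure" where
  "size_biased_tree p =
     distr (\<Pi>\<^sub>M u\<in>words. measure_pmf (pair_pmf p (special_pmf p))) borel grown_tree"

end

theory Submission
  imports Defs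
begin

text \<open>
  Both conditionings are of the form \<open>m < M(\<tau>) \<le> m'\<close>, with \<open>(m, m') = (n - 1, n)\<close> and
  \<open>(m, m') = (n, \<infinity>)\<close>. The theorem holds for every such window as long as \<open>m\<close> tends to infinity and
  some \<open>k\<close> with \<open>p\<^sub>k > 0\<close> satisfies \<open>m < k \<le> m'\<close>; this is \<open>weakly_converges_conditioned\<close>.

  Weak convergence in the local topology follows from convergence of the probabilities of the cylinders
  given by truncating trees at a finite width and depth (\<open>weakly_converges_treeI\<close>). These
  probabilities are computed by induction on the depth, by splitting at the root.

  Let \<open>c\<close> be the probability of the window. If the root has \<open>k \<le> m\<close> children, then one of the \<open>k\<close>
  subtrees has to exceed \<open>m\<close>. The window is a rare event, so to first order exactly one subtree
  does it, and the product rule for differences (\<open>tendsto_prod_diff_quotient\<close>) turns the probability,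
  divided by \<open>c\<close>, into \<open>p\<^sub>k\<close> times a sum over \<open>k\<close> choices of a distinguished child. In that
  distinguished subtree the same conditioning is repeated, while the others are unconditioned
  Galton-Watson trees: this is a special node of finite out-degree, since \<open>p\<^sub>k\<close> times a sum over the
  children is \<open>k p\<^sub>k\<close> times a uniform choice. The series over \<open>k\<close> is dominated by \<open>k p\<^sub>k\<close>, which is
  summable, so the limit may be taken termwise (\<open>tendsto_truncated_product_sums\<close>).

  If the root has \<open>m < k \<le> m'\<close> children, it exceeds \<open>m\<close> by itself, and the subtrees satisfy only
  \<open>M \<le> m'\<close>, a condition that becomes void in the limit. Through any fixed width such a root has
  infinitely many normal children. Its share of \<open>c\<close> is whatever the roots with \<open>k \<le> m\<close> children
  leave over; applying the first part to the window alone, these take the share \<open>\<Sum>k k p\<^sub>k = \<mu>\<close>, so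
  that \<open>1 - \<mu>\<close> remains (\<open>root_in_window_tendsto\<close>). These are the weights of the offspring law of special
  nodes, and the limits solve the recursion that determines the law of the condensation tree
  (\<open>special_law_Suc\<close>).
\<close>

section \<open>Trees, truncations and the local topology\<close>

lemma is_tree_nodes: "is_tree (nodes t)"
  using nodes[of t] by simp

lemma Nil_in_nodes [simp]: "[] \<in> nodes t"
  using is_tree_nodes[of t] by (simp add: is_tree_def)

lemma nodes_subset_words: "nodes t \<subseteq> words"
  using is_tree_nodes[of t] by (simp add: is_tree_def)

lemma nodes_child_iff: "1 \<le> i \<Longrightarrow> u @ [i] \<in> nodes t \<longleftrightarrow> enat i \<le> outdegree t u"
  unfolding outdegree_def using theI'[OF ex1_outdegree[of u t]] by blast

lemma nodes_zero: "0 \<in> set u \<Longrightarrow> u \<notin> nodes t"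
  using nodes_subset_words[of t] by (auto simp: words_def)

lemma nodes_prefix:
  assumes "u @ v \<in> nodes t" shows "u \<in> nodes t"
proof (cases "v = []")
  case False
  then have "u \<in> ancestors (u @ v)"
    using assms nodes_subset_words[of t] by (auto simp: ancestors_def words_def)
  then show ?thesis
    using assms is_tree_nodes[of t] by (auto simp: is_tree_def)
qed (use assms in simp)

lemma outdegree_eqI:
  assumes "\<And>i. 1 \<le> i \<Longrightarrow> u @ [i] \<in> nodes t \<longleftrightarrow> enat i \<le> k"
  shows "outdegree t u = k"
  unfolding outdegree_def using assms ex1_outdegree[of u t] by (intro the1_equality) auto

lemma nodes_root_child_iff: "[i] \<in> nodes t \<longleftrightarrow> 1 \<le> i \<and> enat i \<le> outdegree t []"
  using nodes_child_iff[of i "[]" t] nodes_zero[of "[i]" t] by (cases i) auto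

lemma nodes_subtree_at: "[i] \<in> nodes t \<Longrightarrow> nodes (subtree_at i t) = {v. i # v \<in> nodes t}"
  unfolding subtree_at_def using is_tree_subtree_at[of i t] by (simp add: Tree_inverse)

lemma nodes_Cons_iff:
  "i # v \<in> nodes t \<longleftrightarrow> 1 \<le> i \<and> enat i \<le> outdegree t [] \<and> v \<in> nodes (subtree_at i t)"
  using nodes_subtree_at[of i t] nodes_root_child_iff[of i t] nodes_prefix[of "[i]" v t] by auto

lemma nodes_subtree_at_cases:
  "u \<in> nodes (subtree_at i t) \<longleftrightarrow> (if [i] \<in> nodes t then i # u \<in> nodes t else u = [])"
proof (cases "[i] \<in> nodes t")
  case False
  have "is_tree {[]}"
    by (auto simp: is_tree_def words_def ancestors_def intro!: exI[of _ 0] simp: zero_enat_def)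
  then show ?thesis using False by (simp add: subtree_at_def Tree_inverse)
qed (simp add: nodes_subtree_at)

lemma outdegree_Cons:
  assumes "[i] \<in> nodes t" shows "outdegree t (i # u) = outdegree (subtree_at i t) u"
  using nodes_subtree_at[OF assms] nodes_child_iff[of _ "i # u" t]
  by (intro outdegree_eqI[symmetric]) auto

lemma max_outdegree_le_iff: "max_outdegree t \<le> m \<longleftrightarrow> (\<forall>u\<in>nodes t. outdegree t u \<le> m)"
  by (simp add: max_outdegree_def SUP_le_iff)

lemma max_outdegree_le_iff_subtrees:
  "max_outdegree t \<le> m \<longleftrightarrow> outdegree t [] \<le> m \<and>
     (\<forall>i\<ge>1. enat i \<le> outdegree t [] \<longrightarrow> max_outdegree (subtree_at i t) \<le> m)"
  (is "?l \<longleftrightarrow> ?r")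
proof
  assume ?l
  then show ?r
    unfolding max_outdegree_le_iff
    by (auto simp: nodes_subtree_at nodes_root_child_iff outdegree_Cons[symmetric])
next
  assume r: ?r
  show ?l
    unfolding max_outdegree_le_iff
  proof
    fix u assume u: "u \<in> nodes t"
    show "outdegree t u \<le> m"
    proof (cases u)
      case Nil
      then show ?thesis using r by simp
    next
      case (Cons i v)
      then show ?thesis
        using u r by (auto simp: nodes_Cons_iff outdegree_Cons nodes_root_child_iff max_outdegree_le_iff)
    qed
  qed
qed

lemma max_outdegree_le_enat_iff: "max_outdegree t \<le> enat m \<longleftrightarrow> (\<forall>u. u @ [Suc m] \<notin> nodes t)"
proof -
  have "u @ [Suc m] \<in> nodes t \<longleftrightarrow> u \<in> nodes t \<and> \<not> outdegree t u \<le> enat m" for u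
    using nodes_prefix[of u "[Suc m]" t] nodes_child_iff[of "Suc m" u t]
    by (auto simp: Suc_ile_eq not_le)
  then show ?thesis unfolding max_outdegree_le_iff by blast
qed

text \<open>Width and depth are separate parameters because the inductions below lower the depth while the width
stays fixed. The restriction that defines the distance is the diagonal case.\<close>

definition trunc :: "nat \<Rightarrow> nat \<Rightarrow> ulam_tree \<Rightarrow> nat list set" where
  "trunc w d t = {u\<in>nodes t. length u \<le> d \<and> (\<forall>i\<in>set u. i \<le> w)}"

lemma word_norm_le_iff: "word_norm u \<le> h \<longleftrightarrow> length u \<le> h \<and> (\<forall>i\<in>set u. i \<le> h)"
  unfolding word_norm_def by (subst Max_le_iff) auto

lemma restr_eq_trunc: "restr h t = trunc h h t"
  by (simp add: restr_def trunc_def word_norm_le_iff)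

lemma trunc_0 [simp]: "trunc w 0 t = {[]}"
  by (auto simp: trunc_def)

lemma Nil_in_trunc [simp]: "[] \<in> trunc w d t"
  by (simp add: trunc_def)

lemma Cons_in_trunc_iff: "i # v \<in> trunc w (Suc d) t \<longleftrightarrow>
    1 \<le> i \<and> enat i \<le> min (outdegree t []) (enat w) \<and> v \<in> trunc w d (subtree_at i t)"
  by (auto simp: trunc_def nodes_Cons_iff)

lemma enat_le_eqI:
  assumes "\<And>i. 1 \<le> i \<Longrightarrow> enat i \<le> k \<longleftrightarrow> enat i \<le> k'" shows "k = k'"
proof -
  have "k \<le> k'" if "\<And>i. i \<ge> 1 \<Longrightarrow> enat i \<le> k \<Longrightarrow> enat i \<le> k'" for k k' :: enat
  proof (rule ccontr)
    assume "\<not> k \<le> k'"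
    then obtain n where n: "k' = enat n" "enat (Suc n) \<le> k"
      by (cases k') (auto simp: Suc_ile_eq)
    then show False using that[of "Suc n"] by simp
  qed
  then show ?thesis using assms by (intro antisym) blast+
qed

text \<open>The truncation of depth \<open>d + 1\<close> sees the out-degree of the root up to \<open>w\<close> and the truncations of
depth \<open>d\<close> of the first \<open>w\<close> subtrees, and nothing else. All recursions below rest on this.\<close>

lemma trunc_Suc_eq_iff:
  "trunc w (Suc d) t = trunc w (Suc d) t0 \<longleftrightarrow>
     min (outdegree t []) (enat w) = min (outdegree t0 []) (enat w) \<and>
     (\<forall>i. 1 \<le> i \<and> i \<le> w \<and> enat i \<le> outdegree t [] \<longrightarrow> 
        trunc w d (subtree_at i t) = trunc w d (subtree_at i t0))"
  (is "?l \<longleftrightarrow> ?k \<and> ?s")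
proof
  assume l: ?l
  have root: "enat i \<le> min (outdegree t []) (enat w) \<longleftrightarrow> enat i \<le> min (outdegree t0 []) (enat w)"
    if "1 \<le> i" for i
    using that Cons_in_trunc_iff[of i "[]" w d t] Cons_in_trunc_iff[of i "[]" w d t0] l by simp
  then have k: ?k by (rule enat_le_eqI)
  moreover have ?s
  proof (intro allI impI set_eqI)
    fix i v assume i: "1 \<le> i \<and> i \<le> w \<and> enat i \<le> outdegree t []"
    then have *: "enat i \<le> min (outdegree t []) (enat w)" by simp
    then have "enat i \<le> min (outdegree t0 []) (enat w)" using root[of i] i by blast
    with * show "v \<in> trunc w d (subtree_at i t) \<longleftrightarrow> v \<in> trunc w d (subtree_at i t0)"
      using Cons_in_trunc_iff[of i v w d t] Cons_in_trunc_iff[of i v w d t0] l i by blast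
  qed
  ultimately show "?k \<and> ?s" ..
next
  assume r: "?k \<and> ?s"
  show ?l
  proof (rule set_eqI)
    fix u show "u \<in> trunc w (Suc d) t \<longleftrightarrow> u \<in> trunc w (Suc d) t0"
    proof (cases u)
      case (Cons i v)
      have "1 \<le> i \<Longrightarrow> enat i \<le> min (outdegree t []) (enat w) \<Longrightarrow>
         trunc w d (subtree_at i t) = trunc w d (subtree_at i t0)"
        using r min.bounded_iff[of "enat i" "outdegree t []" "enat w"] enat_ord_simps(1)[of i w] by metis
      moreover have "min (outdegree t []) (enat w) = min (outdegree t0 []) (enat w)" using r by simp
      ultimately show ?thesis unfolding Cons Cons_in_trunc_iff by metis
    qed simp
  qed
qed

definition word_box :: "nat \<Rightarrow> nat \<Rightarrow> nat list set" where
  "word_box w d = {u\<in>words. length u \<le> d \<and> (\<forall>i\<in>set u. i \<le> w)}"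

lemma finite_word_box: "finite (word_box w d)"
proof (rule finite_subset)
  show "word_box w d \<subseteq> {u. set u \<subseteq> {..w} \<and> length u \<le> d}"
    by (auto simp: word_box_def)
  show "finite {u. set u \<subseteq> {..w} \<and> length u \<le> d}"
    by (rule finite_lists_length_le) simp
qed

lemma trunc_eq: "trunc w d t = nodes t \<inter> word_box w d"
  using nodes_subset_words[of t] by (auto simp: trunc_def word_box_def)

lemma dist_tree_le_iff: "dist t t' \<le> (1/2) ^ h \<longleftrightarrow> restr h t = restr h t'"
proof -
  have "dist t t' \<le> (1/2) ^ h \<longleftrightarrow> enat h \<le> agreement t t'"
    by (cases "agreement t t'") (auto simp: dist_ulam_tree_def power_decreasing_iff)
  then show ?thesis by (simp add: le_agreement_iff)
qed

lemma open_tree_iff: "open U \<longleftrightarrow> (\<forall>t\<in>U. \<exists>h. \<forall>t'. restr h t' = restr h t \<longrightarrow> t' \<in> U)"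
  unfolding open_dist
proof (intro ball_cong refl iffI)
  fix t assume "\<exists>e>0. \<forall>y. dist y t < e \<longrightarrow> y \<in> U"
  then obtain e where e: "e > 0" "\<And>y. dist y t < e \<Longrightarrow> y \<in> U" by blast
  obtain h where "(1/2::real) ^ h < e" using real_arch_pow_inv[OF e(1), of "1/2"] by auto
  then show "\<exists>h. \<forall>t'. restr h t' = restr h t \<longrightarrow> t' \<in> U"
    using e(2) by (metis dist_tree_le_iff le_less_trans)
next
  fix t assume "\<exists>h. \<forall>t'. restr h t' = restr h t \<longrightarrow> t' \<in> U"
  then obtain h where "\<And>t'. restr h t' = restr h t \<Longrightarrow> t' \<in> U" by blast
  then show "\<exists>e>0. \<forall>y. dist y t < e \<longrightarrow> y \<in> U"
    by (intro exI[of _ "(1/2)^h"]) (auto simp: dist_tree_le_iff[symmetric])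
qed

lemma mem_nodes_measurable [measurable]: "Measurable.pred borel (\<lambda>t. u \<in> nodes t)"
proof -
  have "open {t. u \<in> nodes t}"
    unfolding open_tree_iff
  proof (intro ballI exI allI impI)
    fix t t' assume t: "t \<in> {t. u \<in> nodes t}" and *: "restr (word_norm u) t' = restr (word_norm u) t"
    have "u \<in> restr (word_norm u) t" using t by (simp add: restr_def)
    then show "t' \<in> {t. u \<in> nodes t}" unfolding *[symmetric] by (simp add: restr_def)
  qed
  then show ?thesis by (auto simp: pred_def)
qed

text \<open>Every open set is a union of cylinders, and there are only countably many cylinders because a
truncation is a finite set of words. Hence the Borel sets are generated by the events that a given word
is a node.\<close>

lemma measurable_treeI:
  assumes m: "\<And>u. u \<in> words \<Longrightarrow> {x\<in>space N. u \<in> nodes (f x)} \<in> sets N"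
  shows "f \<in> N \<rightarrow>\<^sub>M borel"
proof (rule borel_measurableI)
  fix U :: "ulam_tree set" assume U: "open U"
  define C where "C = {(h, s). finite s \<and> s \<subseteq> word_box h h \<and> (\<forall>t. restr h t = s \<longrightarrow> t \<in> U)}"
  have C: "C \<subseteq> UNIV \<times> {s. finite s}" by (auto simp: C_def)
  have "countable C"
    by (rule countable_subset[OF C]) (intro countable_SIGMA countable_Collect_finite; simp)
  have cyl: "{x\<in>space N. restr h (f x) = s} \<in> sets N" if "s \<subseteq> word_box h h" for h s
  proof -
    have eq: "restr h (f x) = s \<longleftrightarrow> (\<forall>u\<in>word_box h h. u \<in> nodes (f x) \<longleftrightarrow> u \<in> s)" for x
      unfolding restr_eq_trunc trunc_eq using that by blast
    have "Measurable.pred N (\<lambda>x. u \<in> nodes (f x))" if "u \<in> word_box h h" for u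
      using m[of u] that by (simp add: pred_def word_box_def)
    then have "Measurable.pred N (\<lambda>x. \<forall>u\<in>word_box h h. u \<in> nodes (f x) \<longleftrightarrow> u \<in> s)"
      by (intro pred_intros_finite finite_word_box pred_intros_logic) auto
    then show ?thesis unfolding eq by (simp add: pred_def)
  qed
  have "f -` U \<inter> space N = (\<Union>(h, s)\<in>C. {x\<in>space N. restr h (f x) = s})"
  proof safe
    fix x assume x: "f x \<in> U" "x \<in> space N"
    then obtain h where "\<forall>t'. restr h t' = restr h (f x) \<longrightarrow> t' \<in> U"
      using U unfolding open_tree_iff by blast
    then have "(h, restr h (f x)) \<in> C"
      by (auto simp: C_def restr_eq_trunc trunc_eq finite_word_box)
    then show "x \<in> (\<Union>(h, s)\<in>C. {x \<in> space N. restr h (f x) = s})"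
      using x by blast
  qed (auto simp: C_def)
  also have "\<dots> \<in> sets N"
    using \<open>countable C\<close> cyl by (intro sets.countable_UN') (auto simp: C_def)
  finally show "f -` U \<inter> space N \<in> sets N" .
qed

lemma trunc_measurable [measurable]: "Measurable.pred borel (\<lambda>t. trunc w d t = s)"
proof (cases "s \<subseteq> word_box w d")
  case True
  have eq: "trunc w d t = s \<longleftrightarrow> (\<forall>u\<in>word_box w d. u \<in> nodes t \<longleftrightarrow> u \<in> s)" for t
    unfolding trunc_eq using True by blast
  have "countable (word_box w d)" by (simp add: finite_word_box countable_finite)
  then show ?thesis unfolding eq by measurable
next
  case False
  then have "trunc w d t = s \<longleftrightarrow> False" for t by (auto simp: trunc_eq)
  then show ?thesis by simp
qed

lemma outdegree_measurable [measurable]: "(\<lambda>t. outdegree t u) \<in> borel \<rightarrow>\<^sub>M count_space UNIV"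
proof -
  have le: "Measurable.pred borel (\<lambda>t. enat i \<le> outdegree t u)" for i
  proof (cases i)
    case (Suc j)
    then show ?thesis by (subst nodes_child_iff[symmetric]) auto
  qed (simp add: zero_enat_def[symmetric])
  have eq: "outdegree t u = k \<longleftrightarrow> (\<forall>i. enat i \<le> outdegree t u \<longleftrightarrow> enat i \<le> k)" for t k
    using enat_le_eqI[of "outdegree t u" k] by blast
  have "Measurable.pred borel (\<lambda>t. outdegree t u = k)" for k
    unfolding eq using le by measurable
  then have "(\<lambda>t. outdegree t u) -` {k} \<inter> space borel \<in> sets borel" for k
    by (simp add: pred_def vimage_def)
  then show ?thesis by (intro measurable_count_space_eq_countable[THEN iffD2]) auto
qed

lemma subtree_at_measurable [measurable]: "subtree_at i \<in> borel \<rightarrow>\<^sub>M borel"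
proof (rule measurable_treeI)
  fix u
  have "Measurable.pred borel (\<lambda>t. u \<in> nodes (subtree_at i t))"
    unfolding nodes_subtree_at_cases by measurable
  then show "{t\<in>space borel. u \<in> nodes (subtree_at i t)} \<in> sets borel" by (simp add: pred_def)
qed

lemma max_outdegree_le_measurable [measurable]: "Measurable.pred borel (\<lambda>t. max_outdegree t \<le> m)"
  by (cases m) (simp_all add: max_outdegree_le_enat_iff)

text \<open>A bounded continuous \<open>f\<close> is approximated from below by its infima over the cylinders of height \<open>h\<close>.
Such an infimum takes finitely many values, so its integrals converge by assumption; under the limit
law they tend to the integral of \<open>f\<close> by dominated convergence. This bounds the lower limit of the
integrals of \<open>f\<close> from below, and the same bound for \<open>- f\<close> takes care of the upper limit.\<close>

lemma weakly_converges_treeI: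
  fixes N :: "'i \<Rightarrow> ulam_tree measure" and F :: "'i filter"
  assumes N: "\<forall>\<^sub>F i in F. prob_space (N i) \<and> sets (N i) = sets borel"
    and L: "prob_space L" "sets L = sets borel"
    and lim: "\<And>h t0. ((\<lambda>i. measure (N i) {t. restr h t = restr h t0})
                 \<longlongrightarrow> measure L {t. restr h t = restr h t0}) F"
  shows "weakly_converges N L F"
proof -
  have restr_meas [measurable]: "Measurable.pred borel (\<lambda>t. restr h t = s)" for h s
    unfolding restr_eq_trunc by measurable
  have low: "\<forall>\<^sub>F i in F. (\<integral>t. f t \<partial>L) - \<epsilon> < (\<integral>t. f t \<partial>N i)"
    if f: "continuous_on UNIV f" and bdd: "bounded (range f)" and \<epsilon>: "\<epsilon> > 0" for f :: "ulam_tree \<Rightarrow> real" and \<epsilon>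
  proof -
    interpret L: prob_space L by (rule L)
    obtain B where B: "\<And>t. \<bar>f t\<bar> \<le> B" using bdd by (auto simp: bounded_iff)
    have fm [measurable]: "f \<in> borel_measurable borel"
      by (rule borel_measurable_continuous_onI[OF f])
    define v where "v h s = (INF t\<in>{t. restr h t = s}. f t)" for h s
    have bb: "bdd_below (f ` A)" for A using B by (intro bdd_belowI2[of _ "-B"]) (simp add: abs_le_iff minus_le_iff)
    have v_le: "v h (restr h t) \<le> f t" for h t
      unfolding v_def by (intro cINF_lower bb) simp
    have v_ge: "-B \<le> v h (restr h t)" for h t
      unfolding v_def using B by (intro cINF_greatest) (auto simp: abs_le_iff minus_le_iff)
    have v_abs: "\<bar>v h (restr h t)\<bar> \<le> B" for h t
      using v_le[of h t] v_ge[of h t] B[of t] by linarith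
    have fin: "finite (Pow (word_box h h))" for h by (simp add: finite_word_box)
    have v_sum: "v h (restr h t) = (\<Sum>s\<in>range (restr h). v h s * indicator {t. restr h t = s} t)" 
      and fin': "finite (range (restr h))" for h t
    proof -
      show fin': "finite (range (restr h))"
        by (rule finite_subset[OF _ fin[of h]]) (auto simp: restr_eq_trunc trunc_eq)
      have "(\<Sum>s\<in>range (restr h). v h s * indicator {t. restr h t = s} t) = 
            (\<Sum>s\<in>range (restr h). if s = restr h t then v h s else 0)"
        by (intro sum.cong) (auto simp: indicator_def)
      then show "v h (restr h t) = (\<Sum>s\<in>range (restr h). v h s * indicator {t. restr h t = s} t)"
        using fin' by simp
    qed
    have vm [measurable]: "(\<lambda>t. v h (restr h t)) \<in> borel_measurable borel" for h
      unfolding v_sum by measurable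
    have intv: "(\<integral>t. v h (restr h t) \<partial>K) = (\<Sum>s\<in>range (restr h). v h s * measure K {t. restr h t = s})"
      if "prob_space K" "sets K = sets borel" for h K
    proof -
      interpret K: prob_space K by (rule that)
      have [measurable_cong]: "sets K = sets borel" by (rule that)
      have [simp]: "space K = UNIV" using sets_eq_imp_space_eq[OF that(2)] by simp
      have "{t. restr h t = s} \<in> sets K" for s
        using restr_meas[of h s] by (simp add: pred_def that(2))
      then show ?thesis unfolding v_sum
        by (subst Bochner_Integration.integral_sum) (auto intro!: integrable_mult_right integrable_real_indicator simp: K.emeasure_eq_measure)
    qed
    have pw: "(\<lambda>h. v h (restr h t)) \<longlonglongrightarrow> f t" for t
    proof (rule LIMSEQ_I)
      fix r :: real assume "r > 0"
      then have "open {t'. f t - r/2 < f t'}"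
        by (intro open_Collect_less continuous_on_const f)
      moreover have "t \<in> {t'. f t - r/2 < f t'}" using \<open>r > 0\<close> by simp
      ultimately have "\<exists>h. \<forall>t'. restr h t' = restr h t \<longrightarrow> t' \<in> {t'. f t - r/2 < f t'}"
        unfolding open_tree_iff by (rule bspec)
      then obtain h where h0: "\<forall>t'. restr h t' = restr h t \<longrightarrow> t' \<in> {t'. f t - r/2 < f t'}"
        by (rule exE)
      have h: "f t - r/2 < f t'" if "restr h t' = restr h t" for t'
        using h0 that by simp
      have "f t - r/2 \<le> v k (restr k t)" if "k \<ge> h" for k
        unfolding v_def
      proof (rule cINF_greatest)
        fix t' assume "t' \<in> {t'. restr k t' = restr k t}"
        then have "restr h t' = restr h t" using restr_mono_eq[of k t' t h] that by simp
        then show "f t - r/2 \<le> f t'" using h[of t'] by simp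
      qed auto
      then have "norm (v k (restr k t) - f t) < r" if "k \<ge> h" for k
        using v_le[of k t] \<open>r > 0\<close> that by (smt (verit) field_sum_of_halves real_norm_def)
      then show "\<exists>no. \<forall>n\<ge>no. norm (v n (restr n t) - f t) < r" by blast
    qed
    \<comment> \<open>By continuity the infima over shrinking cylinders converge to \<open>f\<close> pointwise.\<close>
    have "(\<lambda>h. \<integral>t. v h (restr h t) \<partial>L) \<longlonglongrightarrow> (\<integral>t. f t \<partial>L)"
    proof (rule integral_dominated_convergence)
      have [measurable_cong]: "sets L = sets borel" by (rule L)
      show "f \<in> borel_measurable L" by measurable
      show "(\<lambda>t. v h (restr h t)) \<in> borel_measurable L" for h by measurable
      show "integrable L (\<lambda>_. B)" by simp
      show "AE t in L. (\<lambda>h. v h (restr h t)) \<longlonglongrightarrow> f t" by (rule AE_I2) (rule pw)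
      show "AE t in L. norm (v h (restr h t)) \<le> B" for h using v_abs by simp
    qed
    moreover have "(\<integral>t. f t \<partial>L) - \<epsilon> < (\<integral>t. f t \<partial>L)" using \<epsilon> by linarith
    ultimately have "\<forall>\<^sub>F h in sequentially. (\<integral>t. f t \<partial>L) - \<epsilon> < (\<integral>t. v h (restr h t) \<partial>L)"
      by (rule order_tendstoD(1))
    then obtain h where h: "(\<integral>t. f t \<partial>L) - \<epsilon> < (\<integral>t. v h (restr h t) \<partial>L)"
      by (meson eventually_sequentially order_refl)
    have "((\<lambda>i. \<Sum>s\<in>range (restr h). v h s * measure (N i) {t. restr h t = s}) \<longlongrightarrow>
        (\<Sum>s\<in>range (restr h). v h s * measure L {t. restr h t = s})) F"
      using lim by (intro tendsto_sum tendsto_mult tendsto_const) blast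
    then have "\<forall>\<^sub>F i in F. (\<integral>t. f t \<partial>L) - \<epsilon> < (\<Sum>s\<in>range (restr h). v h s * measure (N i) {t. restr h t = s})"
      using h unfolding intv[OF L] by (rule order_tendstoD(1))
    with N show ?thesis
    proof eventually_elim
      case (elim i)
      interpret K: prob_space "N i" using elim by simp
      have [measurable_cong]: "sets (N i) = sets borel" using elim by simp
      have "(\<integral>t. v h (restr h t) \<partial>N i) \<le> (\<integral>t. f t \<partial>N i)"
      proof (rule integral_mono)
        show "integrable (N i) (\<lambda>t. v h (restr h t))"
          using v_abs[of h] by (intro K.integrable_const_bound[where B=B]) auto
        show "integrable (N i) f"
          using B by (intro K.integrable_const_bound[where B=B]) auto
      qed (rule v_le)
      then show ?case using elim intv[of "N i" h] by simp
    qed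
  qed
  have "((\<lambda>i. \<integral>t. f t \<partial>N i) \<longlongrightarrow> (\<integral>t. f t \<partial>L)) F"
    if f: "continuous_on UNIV f" and bdd: "bounded (range f)" for f :: "ulam_tree \<Rightarrow> real"
  proof (rule order_tendstoI)
    fix a assume "a < (\<integral>t. f t \<partial>L)"
    then show "\<forall>\<^sub>F i in F. a < (\<integral>t. f t \<partial>N i)"
      using low[OF f bdd, of "(\<integral>t. f t \<partial>L) - a"] by simp
  next
    fix a assume a: "(\<integral>t. f t \<partial>L) < a"
    have "bounded (range (\<lambda>t. - f t))" using bdd by (auto simp: bounded_iff)
    from low[OF continuous_on_minus[OF f] this, of "a - (\<integral>t. f t \<partial>L)"] a
    show "\<forall>\<^sub>F i in F. (\<integral>t. f t \<partial>N i) < a" by simp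
  qed
  then show ?thesis using N L by (simp add: weakly_converges_def)
qed

section \<open>Branching of the Galton-Watson tree\<close>

lemma gw_prob_space: "galton_watson M \<tau> p \<Longrightarrow> prob_space M"
  and gw_measurable: "galton_watson M \<tau> p \<Longrightarrow> \<tau> \<in> M \<rightarrow>\<^sub>M borel"
  and gw_outdegree_finite: "galton_watson M \<tau> p \<Longrightarrow> \<omega> \<in> space M \<Longrightarrow> outdegree (\<tau> \<omega>) [] \<noteq> \<infinity>"
  by (auto simp: galton_watson_def locally_finite_def)

lemma gw_outdegree_prob:
  assumes gw: "galton_watson M \<tau> p"
  shows "measure M {\<omega>\<in>space M. outdegree (\<tau> \<omega>) [] = enat k} = pmf p k"
proof -
  have [measurable]: "\<tau> \<in> M \<rightarrow>\<^sub>M borel" by (rule gw_measurable[OF gw])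
  have "pmf p k = pmf (map_pmf enat p) (enat k)"
    by (subst pmf_map_inj') (auto simp: inj_on_def)
  also have "\<dots> = measure (distr M (count_space UNIV) (\<lambda>\<omega>. outdegree (\<tau> \<omega>) [])) {enat k}"
    using gw by (simp add: galton_watson_def measure_pmf_single)
  also have "\<dots> = measure M ((\<lambda>\<omega>. outdegree (\<tau> \<omega>) []) -` {enat k} \<inter> space M)"
    by (rule measure_distr) auto
  also have "(\<lambda>\<omega>. outdegree (\<tau> \<omega>) []) -` {enat k} \<inter> space M = {\<omega>\<in>space M. outdegree (\<tau> \<omega>) [] = enat k}"
    by auto
  finally show ?thesis ..
qed

text \<open>The defining property of a Galton-Watson tree concerns the out-degrees of positive probability
and at least one child. The remaining out-degrees are covered here as well, so that series over all
out-degrees can be formed.\<close>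

lemma gw_branching_point:
  assumes gw: "galton_watson M \<tau> p" and B: "\<And>i. B i \<in> sets borel"
  shows "measure M {\<omega>\<in>space M. outdegree (\<tau> \<omega>) [] = enat k \<and> (\<forall>i\<in>{1..k}. subtree_at i (\<tau> \<omega>) \<in> B i)}
    = pmf p k * (\<Prod>i=1..k. measure M {\<omega>\<in>space M. \<tau> \<omega> \<in> B i})"
proof -
  interpret prob_space M by (rule gw_prob_space[OF gw])
  have [measurable]: "\<tau> \<in> M \<rightarrow>\<^sub>M borel" by (rule gw_measurable[OF gw])
  note [measurable] = B
  define A where "A = {\<omega>\<in>space M. outdegree (\<tau> \<omega>) [] = enat k}"
  have A [measurable]: "A \<in> sets M" unfolding A_def by measurable
  have PA: "prob A = pmf p k" unfolding A_def by (rule gw_outdegree_prob[OF gw])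
  define C where "C = {\<omega>\<in>space M. \<forall>i\<in>{1..k}. subtree_at i (\<tau> \<omega>) \<in> B i}"
  have C [measurable]: "C \<in> sets M" unfolding C_def by measurable
  have eq: "{\<omega>\<in>space M. outdegree (\<tau> \<omega>) [] = enat k \<and> (\<forall>i\<in>{1..k}. subtree_at i (\<tau> \<omega>) \<in> B i)} = A \<inter> C"
    by (auto simp: A_def C_def)
  consider "k = 0" | "pmf p k = 0" | "k \<ge> 1" "pmf p k > 0"
    using pmf_nonneg[of p k] by (cases k) fastforce+
  then show ?thesis
  proof cases
    case 1
    then have "A \<inter> C = A" using sets.sets_into_space[OF A] by (auto simp: C_def)
    then show ?thesis using PA 1 unfolding eq by simp
  next
    case 2
    have "prob (A \<inter> C) \<le> prob A" by (intro finite_measure_mono) auto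
    then show ?thesis using 2 PA measure_nonneg[of M "A \<inter> C"] unfolding eq by simp
  next
    case 3
    define Q where "Q = uniform_measure M A"
    have Q: "prob_space.indep_vars Q (\<lambda>_. borel) (\<lambda>i \<omega>. subtree_at i (\<tau> \<omega>)) {1..k}"
      "\<And>i. i \<in> {1..k} \<Longrightarrow> distr Q borel (\<lambda>\<omega>. subtree_at i (\<tau> \<omega>)) = distr M borel \<tau>"
      using gw 3 unfolding galton_watson_def Q_def A_def Let_def by blast+
    have nz: "emeasure M A \<noteq> 0" using 3 PA by (simp add: emeasure_eq_measure)
    interpret Q: prob_space Q
      unfolding Q_def by (rule prob_space_uniform_measure) (use nz in \<open>auto simp: emeasure_eq_measure\<close>)
    have sQ [measurable_cong]: "sets Q = sets M" by (simp add: Q_def)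
    have spQ: "space Q = space M" by (simp add: Q_def)
    have one: "Q.prob ((\<lambda>\<omega>. subtree_at i (\<tau> \<omega>)) -` B i \<inter> space Q) = prob {\<omega>\<in>space M. \<tau> \<omega> \<in> B i}"
      if "i \<in> {1..k}" for i
    proof -
      have "Q.prob ((\<lambda>\<omega>. subtree_at i (\<tau> \<omega>)) -` B i \<inter> space Q) = measure (distr M borel \<tau>) (B i)"
        unfolding Q(2)[OF that, symmetric] by (rule measure_distr[symmetric]) auto
      also have "\<dots> = prob (\<tau> -` B i \<inter> space M)" by (rule measure_distr) auto
      also have "\<tau> -` B i \<inter> space M = {\<omega>\<in>space M. \<tau> \<omega> \<in> B i}" by auto
      finally show ?thesis .
    qed
    have "C = (\<Inter>i\<in>{1..k}. (\<lambda>\<omega>. subtree_at i (\<tau> \<omega>)) -` B i \<inter> space Q)"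
      using 3 by (auto simp: C_def spQ)
    then have "Q.prob C = (\<Prod>i=1..k. Q.prob ((\<lambda>\<omega>. subtree_at i (\<tau> \<omega>)) -` B i \<inter> space Q))"
      using 3 B by (simp only:) (intro Q.indep_varsD[OF Q(1)], auto)
    also have "\<dots> = (\<Prod>i=1..k. prob {\<omega>\<in>space M. \<tau> \<omega> \<in> B i})"
      by (intro prod.cong refl one)
    finally have "Q.prob C = (\<Prod>i=1..k. prob {\<omega>\<in>space M. \<tau> \<omega> \<in> B i})" .
    moreover have "Q.prob C = prob (A \<inter> C) / prob A"
      unfolding Q_def using nz by (intro measure_uniform_measure) (auto simp: emeasure_eq_measure)
    ultimately show ?thesis using 3 PA unfolding eq by (simp add: field_simps)
  qed
qed

lemma gw_branching:
  assumes gw: "galton_watson M \<tau> p" and B: "\<And>i. B i \<in> sets borel"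
  shows "(\<lambda>k. if k \<in> K then pmf p k * (\<Prod>i=1..k. measure M {\<omega>\<in>space M. \<tau> \<omega> \<in> B i}) else 0) sums
    measure M {\<omega>\<in>space M. \<exists>k\<in>K. outdegree (\<tau> \<omega>) [] = enat k \<and> (\<forall>i\<in>{1..k}. subtree_at i (\<tau> \<omega>) \<in> B i)}"
proof -
  interpret prob_space M by (rule gw_prob_space[OF gw])
  have [measurable]: "\<tau> \<in> M \<rightarrow>\<^sub>M borel" by (rule gw_measurable[OF gw])
  note [measurable] = B
  define E where "E k = (if k \<in> K then {\<omega>\<in>space M. outdegree (\<tau> \<omega>) [] = enat k \<and>
    (\<forall>i\<in>{1..k}. subtree_at i (\<tau> \<omega>) \<in> B i)} else {})" for k
  have E: "range E \<subseteq> sets M"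
  proof safe
    fix k show "E k \<in> sets M" unfolding E_def by (cases "k \<in> K") (simp_all only: if_True if_False, measurable)
  qed
  have "disjoint_family E" by (auto simp: disjoint_family_on_def E_def)
  then have "(\<lambda>k. prob (E k)) sums prob (\<Union>k. E k)" by (intro finite_measure_UNION E)
  moreover have "(\<Union>k. E k) = {\<omega>\<in>space M. \<exists>k\<in>K. outdegree (\<tau> \<omega>) [] = enat k \<and>
      (\<forall>i\<in>{1..k}. subtree_at i (\<tau> \<omega>) \<in> B i)}"
    by (auto simp: E_def split: if_splits)
  moreover have "prob (E k) = (if k \<in> K then pmf p k * (\<Prod>i=1..k. measure M {\<omega>\<in>space M. \<tau> \<omega> \<in> B i}) else 0)" for k
    unfolding E_def by (simp only: gw_branching_point[OF gw B] if_distrib[of prob] measure_empty)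
  ultimately show ?thesis by simp
qed

text \<open>The bound \<open>m\<close> may be \<open>\<infinity>\<close>, which gives the unconditioned law. Differences of two such values are the
probabilities of cylinders intersected with a window for the maximal out-degree.\<close>

definition bounded_law :: "'a measure \<Rightarrow> ('a \<Rightarrow> ulam_tree) \<Rightarrow> enat \<Rightarrow> nat \<Rightarrow> nat \<Rightarrow> ulam_tree \<Rightarrow> real" where
  "bounded_law M \<tau> m w d t0 = 
     measure M {\<omega>\<in>space M. trunc w d (\<tau> \<omega>) = trunc w d t0 \<and> max_outdegree (\<tau> \<omega>) \<le> m}"

text \<open>An out-degree \<open>k\<close> of the root cannot be told from that of \<open>t0\<close> through the width \<open>w\<close>.\<close>

definition same_root :: "nat \<Rightarrow> ulam_tree \<Rightarrow> enat \<Rightarrow> bool" where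
  "same_root w t0 k \<longleftrightarrow> min k (enat w) = min (outdegree t0 []) (enat w)"

text \<open>Children beyond the width are invisible. Truncating their subtrees at depth \<open>0\<close> imposes no condition,
so that a condition on the visible children can be written as one on all children, with a product over
all of \<open>{1..k}\<close>.\<close>

definition child_depth :: "nat \<Rightarrow> nat \<Rightarrow> nat \<Rightarrow> nat" where
  "child_depth w d i = (if i \<le> w then d else 0)"

lemma trunc_Suc_eq_finite:
  assumes "outdegree t [] = enat k"
  shows "trunc w (Suc d) t = trunc w (Suc d) t0 \<longleftrightarrow> same_root w t0 (enat k) \<and>
     (\<forall>i\<in>{1..k}. trunc w (child_depth w d i) (subtree_at i t) = trunc w (child_depth w d i) (subtree_at i t0))"
  unfolding trunc_Suc_eq_iff same_root_def assms child_depth_def by auto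

lemma trunc_Suc_eq_infinite:
  assumes "outdegree t [] = \<infinity>"
  shows "trunc w (Suc d) t = trunc w (Suc d) t0 \<longleftrightarrow> same_root w t0 \<infinity> \<and>
     (\<forall>i\<in>{1..w}. trunc w (child_depth w d i) (subtree_at i t) = trunc w (child_depth w d i) (subtree_at i t0))"
  unfolding trunc_Suc_eq_iff same_root_def assms child_depth_def by auto

lemma bounded_law_0: "bounded_law M \<tau> m w 0 t0 = measure M {\<omega>\<in>space M. max_outdegree (\<tau> \<omega>) \<le> m}"
  by (simp add: bounded_law_def)

text \<open>A maximal out-degree is at most \<open>m\<close> if and only if this holds at the root and in all subtrees, so the
bound is passed on to the factors of the product unchanged.\<close>

lemma bounded_law_Suc:
  assumes gw: "galton_watson M \<tau> p"
  shows "(\<lambda>k. if same_root w t0 (enat k) \<and> enat k \<le> m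
      then pmf p k * (\<Prod>i=1..k. bounded_law M \<tau> m w (child_depth w d i) (subtree_at i t0)) else 0)
    sums bounded_law M \<tau> m w (Suc d) t0"
proof -
  define B where "B i = {t. trunc w (child_depth w d i) t = trunc w (child_depth w d i) (subtree_at i t0)
     \<and> max_outdegree t \<le> m}" for i
  define K where "K = {k. same_root w t0 (enat k) \<and> enat k \<le> m}"
  have B: "B i \<in> sets borel" for i
  proof -
    have "Measurable.pred borel (\<lambda>t. trunc w (child_depth w d i) t = trunc w (child_depth w d i) (subtree_at i t0)
       \<and> max_outdegree t \<le> m)" by measurable
    then show ?thesis by (simp add: B_def pred_def)
  qed
  have bl: "bounded_law M \<tau> m w (child_depth w d i) (subtree_at i t0) = measure M {\<omega>\<in>space M. \<tau> \<omega> \<in> B i}" for i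
    by (simp add: bounded_law_def B_def)
  have set_eq: "{\<omega>\<in>space M. trunc w (Suc d) (\<tau> \<omega>) = trunc w (Suc d) t0 \<and> max_outdegree (\<tau> \<omega>) \<le> m} =
    {\<omega>\<in>space M. \<exists>k\<in>K. outdegree (\<tau> \<omega>) [] = enat k \<and> (\<forall>i\<in>{1..k}. subtree_at i (\<tau> \<omega>) \<in> B i)}"
  proof (rule Collect_cong, rule conj_cong[OF refl])
    fix \<omega> assume "\<omega> \<in> space M"
    then obtain k where k: "outdegree (\<tau> \<omega>) [] = enat k"
      using gw_outdegree_finite[OF gw] by (metis not_enat_eq)
    show "(trunc w (Suc d) (\<tau> \<omega>) = trunc w (Suc d) t0 \<and> max_outdegree (\<tau> \<omega>) \<le> m) \<longleftrightarrow>
      (\<exists>k\<in>K. outdegree (\<tau> \<omega>) [] = enat k \<and> (\<forall>i\<in>{1..k}. subtree_at i (\<tau> \<omega>) \<in> B i))"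
      unfolding trunc_Suc_eq_finite[OF k] max_outdegree_le_iff_subtrees[of "\<tau> \<omega>"] k
      by (auto simp: K_def B_def)
  qed
  show ?thesis
    using gw_branching[OF gw, of B K] B unfolding bounded_law_def[of M \<tau> m w "Suc d"] set_eq bl
    by (simp add: K_def)
qed

text \<open>This is the fixed point equation of the distribution function of the maximal out-degree, obtained from
the previous recursion at width \<open>0\<close>, where the truncation carries no information.\<close>

lemma max_outdegree_law_sums:
  assumes gw: "galton_watson M \<tau> p"
  shows "(\<lambda>k. if enat k \<le> m then pmf p k * bounded_law M \<tau> m w 0 t0 ^ k else 0) sums bounded_law M \<tau> m w 0 t0"
proof -
  have *: "bounded_law M \<tau> m 0 e s = bounded_law M \<tau> m w 0 t0" for e s
  proof -
    have "trunc 0 e t = {[]}" for t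
    proof -
      have "u = []" if "u \<in> nodes t" "\<forall>i\<in>set u. i \<le> 0" for u
        using that nodes_zero[of u t] by (cases u) auto
      then show ?thesis by (auto simp: trunc_def)
    qed
    then show ?thesis by (simp add: bounded_law_def)
  qed
  have "same_root 0 t0 k" for k by (simp add: same_root_def zero_enat_def[symmetric])
  then show ?thesis using bounded_law_Suc[OF gw, of 0 t0 m 0] unfolding * by (simp cong: if_cong)
qed

section \<open>Growing normal and special trees from labels\<close>

lemma nn_integral_count_space_enat:
  "(\<integral>\<^sup>+k. f k \<partial>count_space UNIV) = (\<Sum>n. f (enat n)) + f \<infinity>"
proof -
  have "(\<integral>\<^sup>+k. f k \<partial>count_space UNIV) = 
    (\<integral>\<^sup>+k. f k * indicator (range enat) k \<partial>count_space UNIV) + (\<integral>\<^sup>+k. f k * indicator {\<infinity>} k \<partial>count_space UNIV)"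
    unfolding nn_integral_add[symmetric, OF borel_measurable_count_space borel_measurable_count_space]
  proof (intro nn_integral_cong)
    show "f k = f k * indicator (range enat) k + f k * indicator {\<infinity>} k" for k
      by (cases k) (auto simp: indicator_def)
  qed
  also have "(\<integral>\<^sup>+k. f k * indicator (range enat) k \<partial>count_space UNIV) = (\<integral>\<^sup>+k. f k \<partial>count_space (range enat))"
    by (simp add: nn_integral_count_space_indicator)
  also have "\<dots> = (\<integral>\<^sup>+n. f (enat n) \<partial>count_space UNIV)"
    by (rule nn_integral_bij_count_space[symmetric]) (auto simp: bij_betw_def inj_on_def)
  also have "\<dots> = (\<Sum>n. f (enat n))" by (rule nn_integral_count_space_nat)
  finally show ?thesis by simp
qed

lemma pmf_special_offspring:
  assumes "offspring_mean p \<le> 1"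
  shows "pmf (special_offspring_pmf p) k = (case k of enat n \<Rightarrow> real n * pmf p n
     | \<infinity> \<Rightarrow> 1 - enn2real (offspring_mean p))"
  unfolding special_offspring_pmf_def
proof (rule pmf_embed_pmf)
  have le: "enn2real (offspring_mean p) \<le> 1" using assms by (simp add: enn2real_leI)
  show "\<And>x. 0 \<le> (case x of enat n \<Rightarrow> real n * pmf p n | \<infinity> \<Rightarrow> 1 - enn2real (offspring_mean p))"
    using le by (simp split: enat.split)
  have fin: "offspring_mean p < top" using assms by (simp add: order_le_less_trans)
  have "(\<Sum>n. ennreal (real n * pmf p n)) = offspring_mean p"
    unfolding offspring_mean_def by (simp add: ennreal_mult ennreal_of_nat_eq_real_of_nat)
  then have sum: "(\<Sum>n. ennreal (real n * pmf p n)) = ennreal (enn2real (offspring_mean p))"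
    using fin by simp
  have "ennreal (enn2real (offspring_mean p)) + ennreal (1 - enn2real (offspring_mean p)) = 1"
    using le by (subst ennreal_plus[symmetric]) auto
  then show "(\<integral>\<^sup>+x. ennreal (case x of enat n \<Rightarrow> real n * pmf p n | \<infinity> \<Rightarrow> 1 - enn2real (offspring_mean p)) \<partial>count_space UNIV) = 1"
    unfolding nn_integral_count_space_enat enat.simps sum .
qed

text \<open>The factor \<open>k\<close> of the size-biased weight \<open>k p\<^sub>k\<close> cancels against the uniform choice of the special
child.\<close>

lemma nn_integral_special_pmf:
  assumes "offspring_mean p \<le> 1"
  shows "(\<integral>\<^sup>+x. f x \<partial>measure_pmf (special_pmf p)) =
    (\<Sum>k. ennreal (pmf p k) * (\<Sum>j=1..k. f (enat k, j))) 
     + ennreal (1 - enn2real (offspring_mean p)) * f (\<infinity>, 0)"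
proof -
  have fin: "ennreal (real k * pmf p k) * (\<integral>\<^sup>+x. f x \<partial>measure_pmf (map_pmf (\<lambda>j. (enat k, j)) (pmf_of_set {1..k})))
      = ennreal (pmf p k) * (\<Sum>j=1..k. f (enat k, j))" for k
  proof (cases "k = 0")
    case False
    have "(\<integral>\<^sup>+x. f x \<partial>measure_pmf (map_pmf (\<lambda>j. (enat k, j)) (pmf_of_set {1..k})))
      = (\<Sum>j=1..k. f (enat k, j) * ennreal (1 / real k))"
      using False by (simp add: nn_integral_measure_pmf_finite)
    also have "\<dots> = (\<Sum>j=1..k. f (enat k, j)) * ennreal (1 / real k)"
      by (simp add: sum_distrib_right)
    also have "ennreal (real k * pmf p k) * \<dots> = (ennreal (real k * pmf p k) * ennreal (1 / real k)) * (\<Sum>j=1..k. f (enat k, j))"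
      by (simp only: ac_simps)
    also have "ennreal (real k * pmf p k) * ennreal (1 / real k) = ennreal (pmf p k)"
      using False by (subst ennreal_mult[symmetric]) auto
    finally show ?thesis .
  qed simp
  show ?thesis
    unfolding special_pmf_def nn_integral_bind_pmf nn_integral_measure_pmf[of "special_offspring_pmf p"]
      nn_integral_count_space_enat pmf_special_offspring[OF assms] enat.simps fin
    by simp
qed

text \<open>The subtrees of a tree with special root have special or normal roots. To make growth recursive, it is
therefore described for both types of roots, the type being the boolean parameter: \<open>True\<close> stands for a
special root.\<close>

fun child_flag :: "bool \<Rightarrow> nat \<times> enat \<times> nat \<Rightarrow> nat \<Rightarrow> bool" where
  "child_flag b (m, k, j) i = (b \<and> k \<noteq> \<infinity> \<and> i = j)"

fun root_deg :: "bool \<Rightarrow> nat \<times> enat \<times> nat \<Rightarrow> enat" where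
  "root_deg b (m, k, j) = (if b then k else enat m)"

primrec flag :: "bool \<Rightarrow> labelling \<Rightarrow> nat list \<Rightarrow> bool" where
  "flag b l [] = b"
| "flag b l (i # u) = flag (child_flag b (l []) i) (\<lambda>v. l (i # v)) u"

primrec grown :: "bool \<Rightarrow> labelling \<Rightarrow> nat list \<Rightarrow> bool" where
  "grown b l [] = True"
| "grown b l (i # u) = (1 \<le> i \<and> enat i \<le> root_deg b (l []) \<and> grown (child_flag b (l []) i) (\<lambda>v. l (i # v)) u)"

declare flag.simps(2) [simp del] grown.simps(2) [simp del]

lemma flag_snoc: "flag b l (u @ [i]) = child_flag (flag b l u) (l u) i"
  by (induction u arbitrary: b l) (simp_all add: flag.simps(2))

lemma grown_snoc: "grown b l (u @ [i]) \<longleftrightarrow> grown b l u \<and> 1 \<le> i \<and> enat i \<le> root_deg (flag b l u) (l u)"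
  by (induction u arbitrary: b l) (auto simp: flag.simps(2) grown.simps(2))

lemma special_iff_flag: "special l u \<longleftrightarrow> flag True l u"
proof (induction u rule: rev_induct)
  case (snoc j u)
  have "special l (u @ [j]) \<longleftrightarrow> special l u \<and> (\<exists>m k. l u = (m, enat k, j))"
    by (auto elim: special.cases intro: special.intros)
  then show ?case using snoc by (cases "l u") (auto simp: flag_snoc)
qed (auto intro: special.intros)

lemma grown_nodes_iff_grown: "u \<in> grown_nodes l \<longleftrightarrow> grown True l u"
proof (induction u rule: rev_induct)
  case (snoc i u)
  then show ?case
    by (cases "l u") (simp add: grown_nodes_snoc grown_snoc offspring_def special_iff_flag)
qed (auto intro: grown_nodes.intros)

definition typed_tree :: "bool \<Rightarrow> labelling \<Rightarrow> ulam_tree" where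
  "typed_tree b l = Tree {u. grown b l u}"

lemma is_tree_grown: "is_tree {u. grown b l u}"
proof -
  have prefix: "grown b l (v @ w) \<Longrightarrow> grown b l v" for v w
    by (induction w rule: rev_induct) (auto simp: grown_snoc simp flip: append_assoc)
  have "u \<in> words" if "grown b l u" for u
    using that by (induction u rule: rev_induct) (auto simp: words_def grown_snoc)
  then show ?thesis
    using prefix by (auto simp: is_tree_def ancestors_def grown_snoc)
qed

lemma nodes_typed_tree: "u \<in> nodes (typed_tree b l) \<longleftrightarrow> grown b l u"
  unfolding typed_tree_def by (simp add: Tree_inverse is_tree_grown)

lemma grown_tree_eq: "grown_tree = typed_tree True"
  by (simp add: fun_eq_iff grown_tree_def typed_tree_def grown_nodes_iff_grown[symmetric])

lemma outdegree_typed_tree: "outdegree (typed_tree b l) [] = root_deg b (l [])"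
  by (intro outdegree_eqI) (simp add: nodes_typed_tree grown.simps(2))

lemma grown_cong: "(\<And>v. v \<in> words \<Longrightarrow> l v = l' v) \<Longrightarrow> grown b l u = grown b l' u"
proof (induction u arbitrary: b l l')
  case (Cons i u)
  have "l [] = l' []" by (intro Cons.prems) (simp add: words_def)
  moreover have "grown c (\<lambda>v. l (i # v)) u = grown c (\<lambda>v. l' (i # v)) u" if "1 \<le> i" for c
    using that by (intro Cons.IH Cons.prems) (simp add: words_def)
  ultimately show ?case by (auto simp: grown.simps(2))
qed simp

text \<open>The result is restricted to words, so that it lies in the space of the product measure.\<close>

definition shift :: "nat \<Rightarrow> (nat list \<Rightarrow> 'b) \<Rightarrow> nat list \<Rightarrow> 'b" where
  "shift i l = (\<lambda>v\<in>words. l (i # v))"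

lemma subtree_at_typed_tree:
  assumes "1 \<le> i" "enat i \<le> root_deg b (l [])"
  shows "subtree_at i (typed_tree b l) = typed_tree (child_flag b (l []) i) (shift i l)"
proof -
  have "[i] \<in> nodes (typed_tree b l)" using assms by (simp add: nodes_typed_tree grown.simps(2))
  then have "nodes (subtree_at i (typed_tree b l)) = {v. grown b l (i # v)}"
    by (simp add: nodes_subtree_at nodes_typed_tree)
  also have "\<dots> = {v. grown (child_flag b (l []) i) (shift i l) v}"
  proof (rule Collect_cong)
    fix v
    have "grown (child_flag b (l []) i) (\<lambda>v. l (i # v)) v = grown (child_flag b (l []) i) (shift i l) v"
      by (rule grown_cong) (simp add: shift_def)
    then show "grown b l (i # v) = grown (child_flag b (l []) i) (shift i l) v"
      using assms by (simp add: grown.simps(2))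
  qed
  also have "\<dots> = nodes (typed_tree (child_flag b (l []) i) (shift i l))"
    by (auto simp: nodes_typed_tree)
  finally show ?thesis by (simp add: nodes_inject)
qed

lemma typed_tree_measurable:
  "typed_tree b \<in> (\<Pi>\<^sub>M u\<in>words. measure_pmf D) \<rightarrow>\<^sub>M borel"
proof (rule measurable_treeI)
  let ?P = "\<Pi>\<^sub>M u\<in>words. measure_pmf D"
  have label: "Measurable.pred ?P (\<lambda>l. Q (l u))" if "u \<in> words" for u Q
    using measurable_component_singleton[OF that, of "\<lambda>_. measure_pmf D"]
    by (rule measurable_compose) simp
  have both: "Measurable.pred ?P (\<lambda>l. flag b l u) \<and> Measurable.pred ?P (\<lambda>l. grown b l u)"
    if "u \<in> words" for u
    using that
  proof (induction u rule: rev_induct)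
    case (snoc i u)
    have u: "u \<in> words" using snoc.prems by (simp add: words_def)
    note [measurable] = snoc.IH[OF u, THEN conjunct1] snoc.IH[OF u, THEN conjunct2]
    have split: "Measurable.pred ?P (\<lambda>l. Q (flag b l u) (l u))" for Q
    proof -
      have eq: "Q (flag b l u) (l u) \<longleftrightarrow> (flag b l u \<and> Q True (l u)) \<or> (\<not> flag b l u \<and> Q False (l u))" for l
        by (cases "flag b l u") auto
      note [measurable] = label[OF u, of "Q True"] label[OF u, of "Q False"]
      show ?thesis unfolding eq by measurable
    qed
    note [measurable] = split[of "\<lambda>c x. child_flag c x i"] split[of "\<lambda>c x. enat i \<le> root_deg c x"]
    show ?case unfolding flag_snoc grown_snoc by (intro conjI) measurable
  qed auto
  show "{l\<in>space ?P. u \<in> nodes (typed_tree b l)} \<in> sets ?P" if "u \<in> words" for u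
    using both[OF that] by (simp add: nodes_typed_tree pred_def)
qed

lemma Nil_in_words: "[] \<in> words" and Cons_in_words_iff: "i # u \<in> words \<longleftrightarrow> 1 \<le> i \<and> u \<in> words"
  by (auto simp: words_def)

text \<open>The label of the root and the families of labels above the children live on disjoint sets of words and
are therefore independent; above each child the labels are distributed like the whole family.\<close>

lemma labels_branching:
  fixes D :: "'b pmf"
  defines "P \<equiv> (\<Pi>\<^sub>M u\<in>words. measure_pmf D)"
  assumes B: "\<And>i. B i \<in> sets P"
  shows "measure P {l\<in>space P. l [] = x \<and> (\<forall>i\<in>{1..n}. shift i l \<in> B i)}
    = pmf D x * (\<Prod>i=1..n. measure P (B i))"
proof -
  interpret P: prob_space P unfolding P_def by (rule prob_space_PiM) (rule measure_pmf.prob_space_axioms)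
  have spP: "space P = words \<rightarrow>\<^sub>E UNIV" by (simp add: P_def space_PiM)
  have comp: "(\<lambda>l. l u) \<in> P \<rightarrow>\<^sub>M measure_pmf D" if "u \<in> words" for u
    unfolding P_def using that by (rule measurable_component_singleton)
  have distr1: "distr P (measure_pmf D) (\<lambda>l. l u) = measure_pmf D" if "u \<in> words" for u
    unfolding P_def using that by (intro distr_PiM_component measure_pmf.prob_space_axioms)
  have ind: "P.indep_vars (\<lambda>_. measure_pmf D) (\<lambda>u l. l u) words"
  proof (subst P.indep_vars_iff_distr_eq_PiM')
    have "distr P (Pi\<^sub>M words (\<lambda>_. measure_pmf D)) (\<lambda>x. \<lambda>i\<in>words. x i) = distr P P (\<lambda>x. x)"
      by (rule distr_cong) (auto simp: P_def spP space_PiM)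
    also have "\<dots> = P" by (rule distr_id)
    also have "P = Pi\<^sub>M words (\<lambda>i. distr P (measure_pmf D) (\<lambda>x. x i))"
      unfolding P_def by (rule PiM_cong) (use distr1 in \<open>auto simp: P_def\<close>)
    finally show "distr P (Pi\<^sub>M words (\<lambda>_. measure_pmf D)) (\<lambda>x. \<lambda>i\<in>words. x i) = 
      Pi\<^sub>M words (\<lambda>i. distr P (measure_pmf D) (\<lambda>x. x i))" .
  qed (use comp Nil_in_words in auto)
  \<comment> \<open>Block \<open>0\<close> holds the label of the root, block \<open>i\<close> the labels above the \<open>i\<close>-th child.\<close>
  define K where "K i = (if i = 0 then {[]} else (#) i ` words)" for i :: nat
  have K: "K i \<subseteq> words" for i by (auto simp: K_def words_def)
  have "disjoint_family_on K {0..n}" by (auto simp: disjoint_family_on_def K_def)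
  from P.indep_vars_restrict[OF ind K this]
  have ind2: "P.indep_vars (\<lambda>j. Pi\<^sub>M (K j) (\<lambda>_. measure_pmf D)) (\<lambda>j l. restrict (\<lambda>u. l u) (K j)) {0..n}" .
  define A where "A i = (if i = 0 then {g\<in>space (Pi\<^sub>M (K 0) (\<lambda>_. measure_pmf D)). g [] = x}
    else {g\<in>space (Pi\<^sub>M (K i) (\<lambda>_. measure_pmf D)). shift i g \<in> B i})" for i
  have shiftK: "shift i \<in> Pi\<^sub>M (K i) (\<lambda>_. measure_pmf D) \<rightarrow>\<^sub>M P" if "i \<noteq> 0" for i
    unfolding shift_def P_def using that
    by (intro measurable_restrict measurable_component_singleton) (simp add: K_def)
  have A: "A i \<in> sets (Pi\<^sub>M (K i) (\<lambda>_. measure_pmf D))" for i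
  proof (cases "i = 0")
    case True
    have "(\<lambda>g. g []) \<in> Pi\<^sub>M (K 0) (\<lambda>_. measure_pmf D) \<rightarrow>\<^sub>M measure_pmf D"
      by (intro measurable_component_singleton) (simp add: K_def)
    from measurable_sets[OF this, of "{x}"] show ?thesis
      using True by (simp add: A_def vimage_def Int_def conj_commute)
  next
    case False
    from measurable_sets[OF shiftK[OF False] B[of i]] show ?thesis
      using False by (simp add: A_def vimage_def Int_def conj_commute)
  qed
  have inv: "(\<lambda>l. restrict (\<lambda>u. l u) (K i)) -` A i \<inter> space P =
    (if i = 0 then {l\<in>space P. l [] = x} else {l\<in>space P. shift i l \<in> B i})" for i
    by (auto simp: A_def spP space_PiM K_def shift_def cong: restrict_cong)
  have "P.prob (\<Inter>i\<in>{0..n}. (\<lambda>l. restrict (\<lambda>u. l u) (K i)) -` A i \<inter> space P) =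
    (\<Prod>i\<in>{0..n}. P.prob ((\<lambda>l. restrict (\<lambda>u. l u) (K i)) -` A i \<inter> space P))"
    by (intro P.indep_varsD[OF ind2] A) auto
  also have "(\<Inter>i\<in>{0..n}. (\<lambda>l. restrict (\<lambda>u. l u) (K i)) -` A i \<inter> space P) = 
     {l\<in>space P. l [] = x \<and> (\<forall>i\<in>{1..n}. shift i l \<in> B i)}"
    unfolding inv by (auto split: if_splits)
  also have "(\<Prod>i\<in>{0..n}. P.prob ((\<lambda>l. restrict (\<lambda>u. l u) (K i)) -` A i \<inter> space P)) =
     P.prob {l\<in>space P. l [] = x} * (\<Prod>i=1..n. P.prob {l\<in>space P. shift i l \<in> B i})"
    unfolding inv by (simp add: prod.atLeast_Suc_atMost)
  also have "P.prob {l\<in>space P. l [] = x} = pmf D x"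
  proof -
    have "pmf D x = measure (distr P (measure_pmf D) (\<lambda>l. l [])) {x}"
      by (simp add: distr1 Nil_in_words measure_pmf_single)
    also have "\<dots> = P.prob ((\<lambda>l. l []) -` {x} \<inter> space P)"
      by (rule measure_distr[OF comp[OF Nil_in_words]]) simp
    also have "(\<lambda>l. l []) -` {x} \<inter> space P = {l\<in>space P. l [] = x}" by auto
    finally show ?thesis ..
  qed
  also have "(\<Prod>i=1..n. P.prob {l\<in>space P. shift i l \<in> B i}) = (\<Prod>i=1..n. P.prob (B i))"
  proof (rule prod.cong[OF refl])
    fix i assume i: "i \<in> {1..n}"
    have eq: "distr P P (shift i) = P"
      unfolding P_def shift_def using i
      by (intro distr_PiM_reindex[of words "\<lambda>_. measure_pmf D" "(#) i" words])
         (auto simp: measure_pmf.prob_space_axioms Cons_in_words_iff)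
    have m: "shift i \<in> P \<rightarrow>\<^sub>M P"
      unfolding shift_def P_def using i
      by (intro measurable_restrict measurable_component_singleton) (simp add: Cons_in_words_iff)
    have "P.prob (B i) = measure (distr P P (shift i)) (B i)" by (simp add: eq)
    also have "\<dots> = P.prob (shift i -` B i \<inter> space P)" by (rule measure_distr[OF m B])
    also have "shift i -` B i \<inter> space P = {l\<in>space P. shift i l \<in> B i}" by auto
    finally show "P.prob {l\<in>space P. shift i l \<in> B i} = P.prob (B i)" ..
  qed
  finally show ?thesis .
qed

section \<open>Recursion for the laws of the grown trees\<close>

definition typed_law :: "nat pmf \<Rightarrow> bool \<Rightarrow> nat \<Rightarrow> nat \<Rightarrow> ulam_tree \<Rightarrow> real" where
  "typed_law p b w d t0 = measure (\<Pi>\<^sub>M u\<in>words. measure_pmf (pair_pmf p (special_pmf p)))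
     {l\<in>space (\<Pi>\<^sub>M u\<in>words. measure_pmf (pair_pmf p (special_pmf p))).
        trunc w d (typed_tree b l) = trunc w d t0}"

lemma typed_law_nonneg: "0 \<le> typed_law p b w d t0"
  by (simp add: typed_law_def)

lemma typed_law_0: "typed_law p b w 0 t0 = 1"
proof -
  interpret prob_space "\<Pi>\<^sub>M u\<in>words. measure_pmf (pair_pmf p (special_pmf p))"
    by (rule prob_space_PiM) (rule measure_pmf.prob_space_axioms)
  show ?thesis by (simp add: typed_law_def prob_space)
qed

text \<open>With infinitely many children only the first \<open>w\<close> matter for a truncation of width \<open>w\<close>; with finitely
many, the product over all children is used, as for Galton-Watson trees.\<close>

definition visible_children :: "nat \<Rightarrow> enat \<Rightarrow> nat" where
  "visible_children w k = (case k of enat n \<Rightarrow> n | \<infinity> \<Rightarrow> w)"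

lemma trunc_typed_tree_Suc_iff:
  "trunc w (Suc d) (typed_tree b l) = trunc w (Suc d) t0 \<longleftrightarrow>
    same_root w t0 (root_deg b (l [])) \<and> (\<forall>i\<in>{1..visible_children w (root_deg b (l []))}.
      trunc w (child_depth w d i) (typed_tree (child_flag b (l []) i) (shift i l)) =
      trunc w (child_depth w d i) (subtree_at i t0))"
proof (cases "root_deg b (l [])")
  case (enat k)
  have "subtree_at i (typed_tree b l) = typed_tree (child_flag b (l []) i) (shift i l)" if "i \<in> {1..k}" for i
    using that enat by (intro subtree_at_typed_tree) auto
  then show ?thesis
    unfolding trunc_Suc_eq_finite[OF outdegree_typed_tree[of b l, unfolded enat]]
    by (simp add: enat visible_children_def)
next
  case infinity
  have "subtree_at i (typed_tree b l) = typed_tree (child_flag b (l []) i) (shift i l)" if "i \<in> {1..w}" for i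
    using that infinity by (intro subtree_at_typed_tree) auto
  then show ?thesis
    unfolding trunc_Suc_eq_infinite[OF outdegree_typed_tree[of b l, unfolded infinity]]
    by (simp add: infinity visible_children_def)
qed

text \<open>Given the label of the root, the subtrees above the children are independent and grown from
labellings of the same law, with types read off from that label.\<close>

lemma typed_law_Suc:
  "ennreal (typed_law p b w (Suc d) t0) = (\<integral>\<^sup>+x. ennreal (if same_root w t0 (root_deg b x)
     then \<Prod>i=1..visible_children w (root_deg b x).
        typed_law p (child_flag b x i) w (child_depth w d i) (subtree_at i t0) else 0)
     \<partial>measure_pmf (pair_pmf p (special_pmf p)))"
proof -
  define D where "D = pair_pmf p (special_pmf p)"
  define P where "P = (\<Pi>\<^sub>M u\<in>words. measure_pmf D)"
  interpret P: prob_space P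
    unfolding P_def by (rule prob_space_PiM) (rule measure_pmf.prob_space_axioms)
  have tm [measurable]: "typed_tree c \<in> P \<rightarrow>\<^sub>M borel" for c
    unfolding P_def by (rule typed_tree_measurable)
  have law: "typed_law p c w e t = P.prob {l\<in>space P. trunc w e (typed_tree c l) = trunc w e t}" for c e t
    by (simp add: typed_law_def P_def D_def)
  define B where "B x i = {l\<in>space P. trunc w (child_depth w d i) (typed_tree (child_flag b x i) l) =
      trunc w (child_depth w d i) (subtree_at i t0)}" for x i
  have B: "B x i \<in> sets P" for x i unfolding B_def by measurable
  have shift_space: "shift i l \<in> space P" for i l
    by (simp add: P_def space_PiM shift_def)
  define E where "E x = {l\<in>space P. l [] = x \<and> (\<forall>i\<in>{1..visible_children w (root_deg b x)}. shift i l \<in> B x i)}" for x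
  define X where "X = {x. same_root w t0 (root_deg b x)}"
  have prob_E: "P.prob (E x) = pmf D x * (\<Prod>i=1..visible_children w (root_deg b x). 
       typed_law p (child_flag b x i) w (child_depth w d i) (subtree_at i t0))" for x
    unfolding E_def P_def using B[unfolded P_def]
    by (subst labels_branching) (auto simp: law[unfolded P_def] B_def[unfolded P_def])
  have E: "E x \<in> sets P" for x
  proof -
    have m: "shift i \<in> P \<rightarrow>\<^sub>M P" if "1 \<le> i" for i
      unfolding shift_def P_def using that
      by (intro measurable_restrict measurable_component_singleton) (simp add: Cons_in_words_iff)
    have [measurable]: "Measurable.pred P (\<lambda>l. shift i l \<in> B x i)" if "i \<in> {1..n}" for i n
      using B[of x i] m[of i] that by simp
    have "(\<lambda>l. l []) \<in> P \<rightarrow>\<^sub>M measure_pmf D"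
      unfolding P_def by (rule measurable_component_singleton) (rule Nil_in_words)
    then have [measurable]: "Measurable.pred P (\<lambda>l. l [] = x)"
      by (rule measurable_compose) simp
    show ?thesis unfolding E_def by measurable
  qed
  have eq: "{l\<in>space P. trunc w (Suc d) (typed_tree b l) = trunc w (Suc d) t0} = (\<Union>x\<in>X. E x)"
    unfolding trunc_typed_tree_Suc_iff E_def X_def B_def using shift_space by auto
  have "ennreal (typed_law p b w (Suc d) t0) = emeasure P (\<Union>x\<in>X. E x)"
    unfolding law eq by (simp add: P.emeasure_eq_measure)
  also have "\<dots> = (\<integral>\<^sup>+x. emeasure P (E x) \<partial>count_space X)"
  proof (rule emeasure_UN_countable)
    show "disjoint_family_on E X" unfolding disjoint_family_on_def E_def by blast
  qed (use E in simp_all)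
  also have "\<dots> = (\<integral>\<^sup>+x. emeasure P (E x) * indicator X x \<partial>count_space UNIV)"
    by (subst nn_integral_count_space_indicator) simp_all
  also have "\<dots> = (\<integral>\<^sup>+x. ennreal (pmf D x) * ennreal (if same_root w t0 (root_deg b x)
     then \<Prod>i=1..visible_children w (root_deg b x).
        typed_law p (child_flag b x i) w (child_depth w d i) (subtree_at i t0) else 0) \<partial>count_space UNIV)"
  proof (rule nn_integral_cong)
    fix x
    show "emeasure P (E x) * indicator X x = ennreal (pmf D x) * ennreal (if same_root w t0 (root_deg b x)
     then \<Prod>i=1..visible_children w (root_deg b x).
        typed_law p (child_flag b x i) w (child_depth w d i) (subtree_at i t0) else 0)"
      by (cases "x \<in> X") (simp_all add: P.emeasure_eq_measure prob_E X_def ennreal_mult')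
  qed
  finally show ?thesis by (simp add: nn_integral_measure_pmf D_def)
qed

lemma root_deg_False: "root_deg False x = enat (fst x)"
  and child_flag_False: "child_flag False x i = False"
  by (cases x; simp)+

lemma normal_law_Suc:
  "(\<lambda>k. if same_root w t0 (enat k)
      then pmf p k * (\<Prod>i=1..k. typed_law p False w (child_depth w d i) (subtree_at i t0)) else 0)
    sums typed_law p False w (Suc d) t0" (is "?f sums _")
proof -
  have "ennreal (typed_law p False w (Suc d) t0) = (\<integral>\<^sup>+k. ennreal (if same_root w t0 (enat k) then
      \<Prod>i=1..k. typed_law p False w (child_depth w d i) (subtree_at i t0) else 0) \<partial>measure_pmf p)"
    unfolding typed_law_Suc nn_integral_pair_pmf'
    by (intro nn_integral_cong) (simp add: visible_children_def root_deg_False child_flag_False)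
  also have "\<dots> = (\<Sum>k. ennreal (?f k))"
    unfolding nn_integral_measure_pmf nn_integral_count_space_nat
    by (intro suminf_cong) (simp add: ennreal_mult')
  finally have "(\<lambda>k. ennreal (?f k)) sums ennreal (typed_law p False w (Suc d) t0)"
    by (simp add: sums_iff)
  then show ?thesis
    by (subst (asm) sums_ennreal) (auto intro!: mult_nonneg_nonneg prod_nonneg typed_law_nonneg)
qed

text \<open>The series collects the labels with finitely many children; what it lacks is the contribution of a root
with infinitely many children, all of them normal.\<close>

lemma special_law_Suc:
  assumes "offspring_mean p \<le> 1"
  shows "(\<lambda>k. if same_root w t0 (enat k)
      then pmf p k * (\<Sum>j=1..k. \<Prod>i=1..k. typed_law p (i = j) w (child_depth w d i) (subtree_at i t0)) else 0)
    sums (typed_law p True w (Suc d) t0 - (if same_root w t0 \<infinity> then (1 - enn2real (offspring_mean p)) *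
      (\<Prod>i=1..w. typed_law p False w (child_depth w d i) (subtree_at i t0)) else 0))" (is "?f sums (?s - ?r)")
proof -
  define g where "g x = (if same_root w t0 (root_deg True x)
     then \<Prod>i=1..visible_children w (root_deg True x).
        typed_law p (child_flag True x i) w (child_depth w d i) (subtree_at i t0) else 0)" for x
  have g: "g (m, x) = g (0, x)" for m x
    by (cases x) (simp add: g_def)
  have g_nonneg: "0 \<le> g x" for x
    by (auto simp: g_def intro!: prod_nonneg typed_law_nonneg)
  have r: "0 \<le> ?r"
    using assms by (auto intro!: mult_nonneg_nonneg prod_nonneg typed_law_nonneg simp: enn2real_leI)
  have f_nonneg: "0 \<le> ?f k" for k
    by (auto intro!: mult_nonneg_nonneg prod_nonneg sum_nonneg typed_law_nonneg)
  have "ennreal ?s = (\<integral>\<^sup>+x. ennreal (g (0, x)) \<partial>measure_pmf (special_pmf p))"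
  proof -
    have "ennreal ?s = (\<integral>\<^sup>+m. \<integral>\<^sup>+x. ennreal (g (m, x)) \<partial>measure_pmf (special_pmf p) \<partial>measure_pmf p)"
      unfolding typed_law_Suc g_def by (rule nn_integral_pair_pmf')
    also have "\<dots> = (\<integral>\<^sup>+m. \<integral>\<^sup>+x. ennreal (g (0, x)) \<partial>measure_pmf (special_pmf p) \<partial>measure_pmf p)"
      by (intro nn_integral_cong) (rule arg_cong[OF g])
    finally show ?thesis by simp
  qed
  also have "\<dots> = (\<Sum>k. ennreal (pmf p k) * (\<Sum>j=1..k. ennreal (g (0, enat k, j)))) 
     + ennreal (1 - enn2real (offspring_mean p)) * ennreal (g (0, \<infinity>, 0))"
    by (rule nn_integral_special_pmf[OF assms])
  also have "(\<Sum>k. ennreal (pmf p k) * (\<Sum>j=1..k. ennreal (g (0, enat k, j)))) = (\<Sum>k. ennreal (?f k))"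
  proof (rule suminf_cong)
    fix k
    have "(\<Sum>j=1..k. ennreal (g (0, enat k, j))) = ennreal (\<Sum>j=1..k. g (0, enat k, j))"
      by (rule sum_ennreal) (rule g_nonneg)
    moreover have "pmf p k * (\<Sum>j=1..k. g (0, enat k, j)) = ?f k"
      by (simp add: g_def visible_children_def)
    ultimately show "ennreal (pmf p k) * (\<Sum>j=1..k. ennreal (g (0, enat k, j))) = ennreal (?f k)"
      using ennreal_mult'[of "pmf p k" "\<Sum>j=1..k. g (0, enat k, j)"] by simp
  qed
  also have "ennreal (1 - enn2real (offspring_mean p)) * ennreal (g (0, \<infinity>, 0)) = ennreal ?r"
    using assms by (simp add: g_def visible_children_def ennreal_mult'[symmetric] enn2real_leI)
  finally have eq: "ennreal ?s = (\<Sum>k. ennreal (?f k)) + ennreal ?r" .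
  have fin: "(\<Sum>k. ennreal (?f k)) \<noteq> \<top>"
    using eq by (metis ennreal_neq_top ennreal_add_eq_top)
  have "ennreal ?s = ennreal (enn2real (\<Sum>k. ennreal (?f k)) + ?r)"
    unfolding eq using fin r by (simp add: less_top)
  then have "?s - ?r = enn2real (\<Sum>k. ennreal (?f k))"
    using r by (subst (asm) ennreal_inj) (auto simp: typed_law_nonneg)
  then have "(\<lambda>k. ennreal (?f k)) sums ennreal (?s - ?r)"
    using fin by (simp add: sums_iff less_top)
  moreover have "0 \<le> ?s - ?r" using \<open>?s - ?r = _\<close> by simp
  ultimately show ?thesis
    by (subst (asm) sums_ennreal) (use f_nonneg in auto)
qed

text \<open>Both sides satisfy the same recursion in the depth. In particular the defining property of a
Galton-Watson tree determines its law.\<close>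

lemma normal_law_eq_gw_law:
  fixes M :: "'a measure"
  assumes gw: "galton_watson M \<tau> p"
  shows "typed_law p False w d t0 = bounded_law M \<tau> \<infinity> w d t0"
proof (induction d arbitrary: t0)
  case 0
  interpret prob_space M by (rule gw_prob_space[OF gw])
  show ?case by (simp add: typed_law_0 bounded_law_0 prob_space)
next
  case (Suc d)
  interpret prob_space M by (rule gw_prob_space[OF gw])
  have "typed_law p False w (child_depth w d i) s = bounded_law M \<tau> \<infinity> w (child_depth w d i) s" for i s
    using Suc.IH by (simp add: child_depth_def typed_law_0 bounded_law_0 prob_space)
  then show ?case
    using bounded_law_Suc[OF gw, of w t0 \<infinity> d] normal_law_Suc[of w t0 p d]
    by (simp add: sums_unique2 cong: if_cong)
qed

section \<open>Limits of products and of truncated sums\<close>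

text \<open>This is the product rule: the difference of two products is, to first order, the sum over the factors of
the products in which one factor is replaced by its difference.\<close>

lemma tendsto_prod_diff_quotient:
  fixes x y :: "'i \<Rightarrow> 'j \<Rightarrow> real" and c :: "'i \<Rightarrow> real"
  assumes "finite S"
    and "\<And>j. j \<in> S \<Longrightarrow> ((\<lambda>i. (x i j - y i j) / c i) \<longlongrightarrow> \<delta> j) F"
    and "\<And>j. j \<in> S \<Longrightarrow> ((\<lambda>i. x i j) \<longlongrightarrow> a j) F"
    and "\<And>j. j \<in> S \<Longrightarrow> ((\<lambda>i. y i j) \<longlongrightarrow> a j) F"
  shows "((\<lambda>i. (prod (x i) S - prod (y i) S) / c i) \<longlongrightarrow> (\<Sum>j\<in>S. \<Prod>l\<in>S. if l = j then \<delta> l else a l)) F"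
  using assms
proof (induction S rule: finite_induct)
  case (insert s S)
  have eq: "(prod (x i) (insert s S) - prod (y i) (insert s S)) / c i =
    (x i s - y i s) / c i * prod (x i) S + y i s * ((prod (x i) S - prod (y i) S) / c i)" for i
    using insert.hyps by (simp add: diff_divide_distrib algebra_simps)
  have "((\<lambda>i. (x i s - y i s) / c i * prod (x i) S + y i s * ((prod (x i) S - prod (y i) S) / c i)) \<longlongrightarrow>
     \<delta> s * (\<Prod>l\<in>S. a l) + a s * (\<Sum>j\<in>S. \<Prod>l\<in>S. if l = j then \<delta> l else a l)) F"
    using insert.prems insert.IH by (intro tendsto_add tendsto_mult tendsto_prod) auto
  moreover have "(\<Sum>j\<in>insert s S. \<Prod>l\<in>insert s S. if l = j then \<delta> l else a l) =
    \<delta> s * (\<Prod>l\<in>S. a l) + a s * (\<Sum>j\<in>S. \<Prod>l\<in>S. if l = j then \<delta> l else a l)"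
  proof -
    have "(\<Prod>l\<in>S. if l = s then \<delta> l else a l) = (\<Prod>l\<in>S. a l)"
      using insert.hyps by (intro prod.cong) auto
    moreover have "(\<Sum>j\<in>S. \<Prod>l\<in>insert s S. if l = j then \<delta> l else a l) = 
      (\<Sum>j\<in>S. a s * (\<Prod>l\<in>S. if l = j then \<delta> l else a l))"
      using insert.hyps by (intro sum.cong) auto
    ultimately show ?thesis using insert.hyps by (simp add: sum_distrib_left)
  qed
  ultimately show ?case unfolding eq by simp
qed simp

text \<open>Since the factors are bounded by \<open>1\<close>, a difference of two products of \<open>k\<close> factors is at most \<open>k\<close> times
the largest difference of the factors. After division by \<open>c\<close> the terms are thus dominated by \<open>k q\<^sub>k\<close>, and
Tannery's theorem applies.\<close>

lemma tendsto_truncated_product_sums: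
  fixes x y :: "'i \<Rightarrow> nat \<Rightarrow> real" and c :: "'i \<Rightarrow> real" and m :: "'i \<Rightarrow> nat"
  assumes F: "F \<noteq> bot" and m: "filterlim m at_top F"
    and q: "\<And>k. 0 \<le> q k" "summable (\<lambda>k. real k * q k)"
    and c: "\<forall>\<^sub>F i in F. 0 < c i"
    and bd: "\<And>i j. \<bar>x i j\<bar> \<le> 1" "\<And>i j. \<bar>y i j\<bar> \<le> 1" "\<And>i j. \<bar>x i j - y i j\<bar> \<le> c i"
    and \<delta>: "\<And>j. ((\<lambda>i. (x i j - y i j) / c i) \<longlongrightarrow> \<delta> j) F"
    and x: "\<And>j. ((\<lambda>i. x i j) \<longlongrightarrow> a j) F" and y: "\<And>j. ((\<lambda>i. y i j) \<longlongrightarrow> a j) F"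
  shows "((\<lambda>i. \<Sum>k. if R k \<and> k \<le> m i then q k * ((\<Prod>j=1..k. x i j) - (\<Prod>j=1..k. y i j)) / c i else 0) \<longlongrightarrow>
    (\<Sum>k. if R k then q k * (\<Sum>j=1..k. \<Prod>l=1..k. if l = j then \<delta> l else a l) else 0)) F"
proof -
  let ?f = "\<lambda>k i. if R k \<and> k \<le> m i then q k * ((\<Prod>j=1..k. x i j) - (\<Prod>j=1..k. y i j)) / c i else 0"
  have pw: "((?f k) \<longlongrightarrow> (if R k then q k * (\<Sum>j=1..k. \<Prod>l=1..k. if l = j then \<delta> l else a l) else 0)) F" for k
  proof (cases "R k")
    case True
    have "((\<lambda>i. q k * (((\<Prod>j=1..k. x i j) - (\<Prod>j=1..k. y i j)) / c i)) \<longlongrightarrow> 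
        q k * (\<Sum>j=1..k. \<Prod>l=1..k. if l = j then \<delta> l else a l)) F"
      by (intro tendsto_mult tendsto_const tendsto_prod_diff_quotient \<delta> x y) simp
    moreover have "\<forall>\<^sub>F i in F. k \<le> m i" using m by (simp add: filterlim_at_top)
    then have "\<forall>\<^sub>F i in F. q k * (((\<Prod>j=1..k. x i j) - (\<Prod>j=1..k. y i j)) / c i) = ?f k i"
      by eventually_elim (use True in simp)
    ultimately have "((?f k) \<longlongrightarrow> q k * (\<Sum>j=1..k. \<Prod>l=1..k. if l = j then \<delta> l else a l)) F"
      by (rule Lim_transform_eventually)
    then show ?thesis using True by simp
  qed simp
  have dom: "norm (?f k i) \<le> real k * q k" if "0 < c i" for k i
  proof -
    have "\<bar>(\<Prod>j=1..k. x i j) - (\<Prod>j=1..k. y i j)\<bar> \<le> (\<Sum>j=1..k. \<bar>x i j - y i j\<bar>)"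
      using norm_prod_diff[of "{1..k}" "x i" "y i"] bd by simp
    also have "\<dots> \<le> (\<Sum>j=1..k. c i)" by (intro sum_mono bd)
    finally have "\<bar>(\<Prod>j=1..k. x i j) - (\<Prod>j=1..k. y i j)\<bar> / c i \<le> real k"
      using that by (simp add: divide_le_eq)
    then have "q k * (\<bar>(\<Prod>j=1..k. x i j) - (\<Prod>j=1..k. y i j)\<bar> / c i) \<le> q k * real k"
      by (intro mult_left_mono q)
    then show ?thesis using q(1)[of k] that by (simp add: abs_mult mult.commute)
  qed
  have "\<forall>\<^sub>F (k, i) in at_top \<times>\<^sub>F F. norm (?f k i) \<le> real k * q k"
  proof -
    have "\<forall>\<^sub>F z in at_top \<times>\<^sub>F F. 0 < c (snd z)"
      using filterlim_snd c by (rule eventually_compose_filterlim[rotated])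
    then show ?thesis unfolding case_prod_beta by (rule eventually_mono) (rule dom)
  qed
  from tannerys_theorem[OF pw this q(2) F] show ?thesis by blast
qed


section \<open>Conditioning on a window for the maximal out-degree\<close>

context
  fixes p :: "nat pmf" and M :: "'a measure" and \<tau> :: "'a \<Rightarrow> ulam_tree"
  assumes subcritical: "offspring_mean p < 1"
    and gw: "galton_watson M \<tau> p"
begin

interpretation prob_space M
  by (rule gw_prob_space[OF gw])

lemma tau_measurable [measurable]: "\<tau> \<in> M \<rightarrow>\<^sub>M borel"
  by (rule gw_measurable[OF gw])

lemma mean_sums: "(\<lambda>k. real k * pmf p k) sums enn2real (offspring_mean p)"
proof -
  have "(\<Sum>k. ennreal (real k * pmf p k)) = offspring_mean p"
    unfolding offspring_mean_def by (simp add: ennreal_mult ennreal_of_nat_eq_real_of_nat)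
  then have "(\<lambda>k. ennreal (real k * pmf p k)) sums ennreal (enn2real (offspring_mean p))"
    using subcritical by (simp add: sums_iff order_less_trans)
  then show ?thesis by (subst (asm) sums_ennreal) auto
qed

lemma mean_less_1: "enn2real (offspring_mean p) < 1"
proof -
  have "offspring_mean p < top" using subcritical by (rule order_less_trans) simp
  then have "ennreal (enn2real (offspring_mean p)) < ennreal 1" using subcritical by simp
  then show ?thesis by (subst (asm) ennreal_less_iff) auto
qed

lemma pmf_sums_1: "pmf p sums 1"
proof -
  have "(\<Sum>k. ennreal (pmf p k)) = 1"
    using nn_integral_pmf_eq_1[of p] by (simp add: nn_integral_count_space_nat)
  then have "(\<lambda>k. ennreal (pmf p k)) sums ennreal 1" by (simp add: sums_iff)
  then show ?thesis by (subst (asm) sums_ennreal) auto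
qed

abbreviation law where "law \<equiv> bounded_law M \<tau>"
abbreviation max_cdf where "max_cdf m \<equiv> prob {\<omega>\<in>space M. max_outdegree (\<tau> \<omega>) \<le> m}"

lemma law_bounds: "0 \<le> law m w d t0" "law m w d t0 \<le> 1"
  by (simp_all add: bounded_law_def)

lemma law_mono:
  assumes "m \<le> m'" shows "law m w d t0 \<le> law m' w d t0"
  unfolding bounded_law_def
proof (rule finite_measure_mono)
  show "{\<omega>\<in>space M. trunc w d (\<tau> \<omega>) = trunc w d t0 \<and> max_outdegree (\<tau> \<omega>) \<le> m'} \<in> sets M"
    by measurable
qed (use assms in auto)

lemma law_increment:
  assumes "m \<le> m'"
  shows "law m' w d t0 - law m w d t0 =
    prob {\<omega>\<in>space M. trunc w d (\<tau> \<omega>) = trunc w d t0 \<and> m < max_outdegree (\<tau> \<omega>) \<and> max_outdegree (\<tau> \<omega>) \<le> m'}"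
proof -
  let ?A = "\<lambda>m. {\<omega>\<in>space M. trunc w d (\<tau> \<omega>) = trunc w d t0 \<and> max_outdegree (\<tau> \<omega>) \<le> m}"
  have "prob (?A m' - ?A m) = prob (?A m') - prob (?A m)"
    using assms by (intro finite_measure_Diff) (measurable, auto)
  moreover have "?A m' - ?A m = {\<omega>\<in>space M. trunc w d (\<tau> \<omega>) = trunc w d t0 \<and>
     m < max_outdegree (\<tau> \<omega>) \<and> max_outdegree (\<tau> \<omega>) \<le> m'}" by auto
  ultimately show ?thesis by (simp add: bounded_law_def)
qed

text \<open>The increment is the probability of a cylinder intersected with the event that the maximal
out-degree lies above \<open>m\<close> and not above \<open>m'\<close>, hence at most the probability of that event. This is what makes the domination by \<open>k p\<^sub>k\<close> possible.\<close>

lemma law_increment_le: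
  assumes "m \<le> m'"
  shows "law m' w d t0 - law m w d t0 \<le> max_cdf m' - max_cdf m"
proof -
  have "law m' w d t0 - law m w d t0 \<le> law m' w 0 t0 - law m w 0 t0"
    unfolding law_increment[OF assms]
  proof (rule finite_measure_mono)
    have "{\<omega>\<in>space M. trunc w 0 (\<tau> \<omega>) = trunc w 0 t0 \<and> m < max_outdegree (\<tau> \<omega>) \<and> max_outdegree (\<tau> \<omega>) \<le> m'}
      = {\<omega>\<in>space M. max_outdegree (\<tau> \<omega>) \<le> m'} - {\<omega>\<in>space M. max_outdegree (\<tau> \<omega>) \<le> m}"
      by auto
    also have "\<dots> \<in> sets M" by measurable
    finally show "{\<omega>\<in>space M. trunc w 0 (\<tau> \<omega>) = trunc w 0 t0 \<and> m < max_outdegree (\<tau> \<omega>) \<and> max_outdegree (\<tau> \<omega>) \<le> m'} \<in> sets M" .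
  qed auto
  then show ?thesis by (simp add: bounded_law_0)
qed

lemma max_cdf_sums: "(\<lambda>k. if enat k \<le> m then pmf p k * max_cdf m ^ k else 0) sums max_cdf m"
  using max_outdegree_law_sums[OF gw, of m undefined undefined] by (simp only: bounded_law_0)

lemma bernoulli_power: "1 - x ^ k \<le> real k * (1 - x)" if "0 \<le> x" for x :: real
  using Bernoulli_inequality[of "x - 1" k] that by (simp add: algebra_simps)

text \<open>A maximal out-degree above \<open>m\<close> is reached by the root or by one of its children's subtrees, so its
probability \<open>b\<close> satisfies \<open>b \<le> P(k > m) + \<mu> b\<close>.\<close>

lemma max_outdegree_tail_bound:
  "1 - max_cdf (enat m) \<le> (1 - (\<Sum>k\<le>m. pmf p k)) / (1 - enn2real (offspring_mean p))"
proof -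
  let ?b = "1 - max_cdf (enat m)"
  have "(\<lambda>k. pmf p k - (if enat k \<le> enat m then pmf p k * max_cdf (enat m) ^ k else 0)) sums ?b"
    by (intro sums_diff pmf_sums_1 max_cdf_sums)
  moreover have "(\<lambda>k. real k * pmf p k * ?b + (pmf p k - (if k \<in> {..m} then pmf p k else 0))) sums
     (enn2real (offspring_mean p) * ?b + (1 - (\<Sum>k\<le>m. pmf p k)))"
    by (intro sums_add sums_mult2 sums_diff mean_sums pmf_sums_1 sums_If_finite_set) simp
  ultimately have "?b \<le> enn2real (offspring_mean p) * ?b + (1 - (\<Sum>k\<le>m. pmf p k))"
  proof (rule sums_le[rotated])
    fix k
    have "pmf p k * (1 - max_cdf (enat m) ^ k) \<le> pmf p k * (real k * ?b)"
      by (intro mult_left_mono bernoulli_power) auto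
    moreover have "0 \<le> real k * pmf p k * ?b" by simp
    ultimately show "pmf p k - (if enat k \<le> enat m then pmf p k * max_cdf (enat m) ^ k else 0) \<le>
       real k * pmf p k * ?b + (pmf p k - (if k \<in> {..m} then pmf p k else 0))"
      by (simp add: algebra_simps)
  qed
  then have "?b * (1 - enn2real (offspring_mean p)) \<le> 1 - (\<Sum>k\<le>m. pmf p k)"
    by (simp add: algebra_simps)
  then show ?thesis using mean_less_1 by (simp add: pos_le_divide_eq)
qed

lemma max_cdf_tendsto_1: "(\<lambda>m. max_cdf (enat m)) \<longlonglongrightarrow> 1"
proof (rule tendsto_sandwich)
  have "(\<lambda>m. \<Sum>k\<le>m. pmf p k) \<longlonglongrightarrow> 1"
    using pmf_sums_1 by (simp add: sums_def_le)
  then have "(\<lambda>m. 1 - (1 - (\<Sum>k\<le>m. pmf p k)) / (1 - enn2real (offspring_mean p))) \<longlonglongrightarrow>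
     1 - (1 - 1) / (1 - enn2real (offspring_mean p))"
    using mean_less_1 by (intro tendsto_intros) auto
  then show "(\<lambda>m. 1 - (1 - (\<Sum>k\<le>m. pmf p k)) / (1 - enn2real (offspring_mean p))) \<longlonglongrightarrow> 1" by simp
  show "\<forall>\<^sub>F m in sequentially. 1 - (1 - (\<Sum>k\<le>m. pmf p k)) / (1 - enn2real (offspring_mean p)) \<le> max_cdf (enat m)"
    using max_outdegree_tail_bound by (intro always_eventually allI) (smt (verit))
qed (auto intro: tendsto_const)

context
  fixes F :: "'i filter" and m :: "'i \<Rightarrow> nat" and m' :: "'i \<Rightarrow> enat"
  assumes F: "F \<noteq> bot" and m_lim: "filterlim m at_top F" and m_less: "\<And>i. enat (m i) \<le> m' i"
    and reach: "\<forall>\<^sub>F i in F. \<exists>k. m i < k \<and> enat k \<le> m' i \<and> 0 < pmf p k"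
begin

abbreviation window_prob where "window_prob i \<equiv> max_cdf (m' i) - max_cdf (enat (m i))"

lemma max_cdf_lower_tendsto: "((\<lambda>i. max_cdf (enat (m i))) \<longlongrightarrow> 1) F"
  using filterlim_compose[OF max_cdf_tendsto_1 m_lim] .

text \<open>The bound on the maximal out-degree costs at most the probability that it is exceeded. Both ends of the
window tend to infinity, so both laws tend to the unconditioned one.\<close>

lemma law_lower_tendsto: "((\<lambda>i. law (enat (m i)) w d t0) \<longlongrightarrow> law \<infinity> w d t0) F"
  and law_upper_tendsto: "((\<lambda>i. law (m' i) w d t0) \<longlongrightarrow> law \<infinity> w d t0) F"
proof -
  have Qinf: "max_cdf \<infinity> = 1" by (simp add: prob_space)
  have lb: "law \<infinity> w d t0 - (1 - max_cdf (enat (m i))) \<le> law (enat (m i)) w d t0" for i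
    using law_increment_le[of "enat (m i)" \<infinity> w d t0] Qinf by simp
  have "((\<lambda>i. law \<infinity> w d t0 - (1 - max_cdf (enat (m i)))) \<longlongrightarrow> law \<infinity> w d t0 - (1 - 1)) F"
    by (intro tendsto_intros max_cdf_lower_tendsto)
  then have lim: "((\<lambda>i. law \<infinity> w d t0 - (1 - max_cdf (enat (m i)))) \<longlongrightarrow> law \<infinity> w d t0) F" by simp
  show lower: "((\<lambda>i. law (enat (m i)) w d t0) \<longlongrightarrow> law \<infinity> w d t0) F"
    by (rule tendsto_sandwich[OF _ _ lim tendsto_const])
       (auto intro!: always_eventually lb law_mono)
  show "((\<lambda>i. law (m' i) w d t0) \<longlongrightarrow> law \<infinity> w d t0) F"
    by (rule tendsto_sandwich[OF _ _ lower tendsto_const])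
       (auto intro!: always_eventually law_mono m_less)
qed

lemma max_cdf_upper_tendsto: "((\<lambda>i. max_cdf (m' i)) \<longlongrightarrow> 1) F"
  using law_upper_tendsto[of undefined 0 undefined] by (simp add: bounded_law_0 prob_space)

text \<open>A root with \<open>k \<le> m\<close> children needs a subtree in the window, whence the difference of products; a root
with \<open>m < k \<le> m'\<close> children exceeds \<open>m\<close> by itself, so its subtrees only have to respect the upper bound \<open>m'\<close>.\<close>

lemma increment_split:
  "(\<lambda>k. (if same_root w t0 (enat k) \<and> k \<le> m i then pmf p k *
       ((\<Prod>j=1..k. law (m' i) w (child_depth w d j) (subtree_at j t0)) -
        (\<Prod>j=1..k. law (enat (m i)) w (child_depth w d j) (subtree_at j t0))) else 0) +
     (if same_root w t0 (enat k) \<and> m i < k \<and> enat k \<le> m' i then pmf p k *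
       (\<Prod>j=1..k. law (m' i) w (child_depth w d j) (subtree_at j t0)) else 0))
   sums (law (m' i) w (Suc d) t0 - law (enat (m i)) w (Suc d) t0)"
proof -
  have le: "enat k \<le> m' i" if "k \<le> m i" for k
    using that m_less[of i] by (metis enat_ord_simps(1) order_trans)
  show ?thesis
    by (rule sums_cong[THEN iffD1, OF _ sums_diff[OF bounded_law_Suc[OF gw] bounded_law_Suc[OF gw]]])
       (auto simp: algebra_simps le)
qed

lemma max_cdf_increment_split:
  "(\<lambda>k. (if k \<le> m i then pmf p k * (max_cdf (m' i) ^ k - max_cdf (enat (m i)) ^ k) else 0) +
     (if m i < k \<and> enat k \<le> m' i then pmf p k * max_cdf (m' i) ^ k else 0)) sums window_prob i"
proof -
  have le: "enat k \<le> m' i" if "k \<le> m i" for k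
    using that m_less[of i] by (metis enat_ord_simps(1) order_trans)
  show ?thesis
    by (rule sums_cong[THEN iffD1, OF _ sums_diff[OF max_cdf_sums max_cdf_sums]])
       (auto simp: algebra_simps le)
qed

lemma max_cdf_lower_le_upper: "max_cdf (enat (m i)) \<le> max_cdf (m' i)"
  using law_mono[OF m_less, of i undefined 0 undefined] by (simp add: bounded_law_0)

text \<open>The window has positive probability because the root may fall into it while the subtrees
stay below its upper end.\<close>

lemma window_prob_pos: "\<forall>\<^sub>F i in F. 0 < window_prob i"
proof -
  have "\<forall>\<^sub>F i in F. 0 < max_cdf (m' i)" using max_cdf_upper_tendsto by (rule order_tendstoD(1)) simp
  with reach show ?thesis
  proof eventually_elim
    case (elim i)
    then obtain k where k: "m i < k" "enat k \<le> m' i" "0 < pmf p k" by blast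
    let ?f = "\<lambda>k. (if k \<le> m i then pmf p k * (max_cdf (m' i) ^ k - max_cdf (enat (m i)) ^ k) else 0) +
     (if m i < k \<and> enat k \<le> m' i then pmf p k * max_cdf (m' i) ^ k else 0)"
    have nn: "0 \<le> ?f j" for j
      using max_cdf_lower_le_upper[of i] by (auto intro!: mult_nonneg_nonneg power_mono)
    have "0 < ?f k" using k elim(2) by simp
    then show ?case
      using suminf_pos2[OF sums_summable[OF max_cdf_increment_split[of i]] nn] sums_unique[OF max_cdf_increment_split[of i]]
      by simp
  qed
qed

text \<open>The probability that the maximal out-degree and the out-degree of the root both lie in the window, as
the value of its series.\<close>

abbreviation root_in_window where
  "root_in_window i \<equiv> \<Sum>k. if m i < k \<and> enat k \<le> m' i then pmf p k * max_cdf (m' i) ^ k else 0"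

lemma summable_truncated: "summable (\<lambda>k. if R k \<and> k \<le> m i then f k else 0 :: real)"
  by (rule summable_finite[of "{..m i}"]) auto

lemma root_in_window_sums:
  "(\<lambda>k. if m i < k \<and> enat k \<le> m' i then pmf p k * max_cdf (m' i) ^ k else 0) sums
    (window_prob i - (\<Sum>k. if True \<and> k \<le> m i then pmf p k * (max_cdf (m' i) ^ k - max_cdf (enat (m i)) ^ k) else 0))"
  using sums_diff[OF max_cdf_increment_split[of i] summable_sums[OF summable_truncated[of "\<lambda>_. True" i]],
     of "\<lambda>k. pmf p k * (max_cdf (m' i) ^ k - max_cdf (enat (m i)) ^ k)"] by simp

text \<open>In the limit the roots with at most \<open>m\<close> children have the share \<open>\<Sum>k k p\<^sub>k\<close> of the window, so the
complementary share is known without any estimate of \<open>p\<^sub>n\<close> or of the tail of \<open>p\<close>, however irregular.\<close>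

lemma root_in_window_tendsto: "((\<lambda>i. root_in_window i / window_prob i) \<longlongrightarrow> 1 - enn2real (offspring_mean p)) F"
proof -
  have "((\<lambda>i. window_prob i / window_prob i) \<longlongrightarrow> 1) F"
    by (rule Lim_transform_eventually[OF tendsto_const])
       (use window_prob_pos in \<open>eventually_elim, simp\<close>)
  then have "((\<lambda>i. \<Sum>k. if True \<and> k \<le> m i then pmf p k * ((\<Prod>j=1..k. max_cdf (m' i)) - (\<Prod>j=1..k. max_cdf (enat (m i)))) / window_prob i else 0) \<longlongrightarrow>
    (\<Sum>k. if True then pmf p k * (\<Sum>j=1..k. \<Prod>l=1..k. if l = j then 1 else 1) else 0)) F"
    using max_cdf_lower_le_upper max_cdf_lower_tendsto max_cdf_upper_tendsto sums_summable[OF mean_sums]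
    by (intro tendsto_truncated_product_sums[OF F m_lim _ _ window_prob_pos]) auto
  moreover have "(\<Sum>k. if True then pmf p k * (\<Sum>j=1..k. \<Prod>l=1..k. if l = j then 1 else 1) else 0) = enn2real (offspring_mean p)"
    using sums_unique[OF mean_sums] by (simp add: mult.commute)
  ultimately have lim: "((\<lambda>i. \<Sum>k. if True \<and> k \<le> m i then pmf p k * (max_cdf (m' i) ^ k - max_cdf (enat (m i)) ^ k) / window_prob i else 0) \<longlongrightarrow>
    enn2real (offspring_mean p)) F"
    by (simp cong: if_cong)
  have "((\<lambda>i. 1 - (\<Sum>k. if True \<and> k \<le> m i then pmf p k * (max_cdf (m' i) ^ k - max_cdf (enat (m i)) ^ k) / window_prob i else 0)) \<longlongrightarrow>
    1 - enn2real (offspring_mean p)) F"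
    by (intro tendsto_intros lim)
  moreover have "\<forall>\<^sub>F i in F. 1 - (\<Sum>k. if True \<and> k \<le> m i then pmf p k * (max_cdf (m' i) ^ k - max_cdf (enat (m i)) ^ k) / window_prob i else 0)
     = root_in_window i / window_prob i"
    using window_prob_pos
  proof eventually_elim
    case (elim i)
    have "(\<Sum>k. if True \<and> k \<le> m i then pmf p k * (max_cdf (m' i) ^ k - max_cdf (enat (m i)) ^ k) / window_prob i else 0) =
      (\<Sum>k. (if True \<and> k \<le> m i then pmf p k * (max_cdf (m' i) ^ k - max_cdf (enat (m i)) ^ k) else 0) / window_prob i)"
      by (intro suminf_cong) simp
    also have "\<dots> = (\<Sum>k. if True \<and> k \<le> m i then pmf p k * (max_cdf (m' i) ^ k - max_cdf (enat (m i)) ^ k) else 0) / window_prob i"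
      by (rule suminf_divide[OF summable_truncated])
    finally show ?case
      using elim sums_unique[OF root_in_window_sums[of i]] by (simp add: field_simps)
  qed
  ultimately show ?thesis by (rule Lim_transform_eventually)
qed

text \<open>The limits of the two parts of \<open>increment_split\<close>, divided by the probability of the window, are the two
contributions to the law of the special tree in \<open>special_law_Suc\<close>. The hypothesis is also needed for
depth \<open>0\<close>, which stands for the children beyond the width.\<close>

lemma increment_ratio_step:
  assumes IH: "\<And>e s. e \<in> {0, d} \<Longrightarrow>
    ((\<lambda>i. (law (m' i) w e s - law (enat (m i)) w e s) / window_prob i) \<longlongrightarrow> typed_law p True w e s) F"
  shows "((\<lambda>i. (law (m' i) w (Suc d) t0 - law (enat (m i)) w (Suc d) t0) / window_prob i) \<longlongrightarrow> typed_law p True w (Suc d) t0) F"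
proof -
  define x where "x i j = law (m' i) w (child_depth w d j) (subtree_at j t0)" for i j
  define y where "y i j = law (enat (m i)) w (child_depth w d j) (subtree_at j t0)" for i j
  define a where "a j = typed_law p False w (child_depth w d j) (subtree_at j t0)" for j
  define \<delta> where "\<delta> j = typed_law p True w (child_depth w d j) (subtree_at j t0)" for j
  define R where "R k = same_root w t0 (enat k)" for k
  define \<mu> where "\<mu> = enn2real (offspring_mean p)"
  define head where "head i = (\<Sum>k. if R k \<and> k \<le> m i then pmf p k * ((\<Prod>j=1..k. x i j) - (\<Prod>j=1..k. y i j)) / window_prob i else 0)" for i
  define tail where "tail i = (if same_root w t0 \<infinity> then (\<Prod>j=1..w. x i j) / max_cdf (m' i) ^ w * (root_in_window i / window_prob i) else 0)" for i
  have xa: "((\<lambda>i. x i j) \<longlongrightarrow> a j) F" for j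
    unfolding x_def a_def normal_law_eq_gw_law[OF gw] by (rule law_upper_tendsto)
  have ya: "((\<lambda>i. y i j) \<longlongrightarrow> a j) F" for j
    unfolding y_def a_def normal_law_eq_gw_law[OF gw] by (rule law_lower_tendsto)
  have "(head \<longlongrightarrow> (\<Sum>k. if R k then pmf p k * (\<Sum>j=1..k. \<Prod>l=1..k. if l = j then \<delta> l else a l) else 0)) F"
    unfolding head_def
  proof (rule tendsto_truncated_product_sums[OF F m_lim _ _ window_prob_pos])
    show "summable (\<lambda>k. real k * pmf p k)" by (rule sums_summable[OF mean_sums])
    show "\<bar>x i j\<bar> \<le> 1" "\<bar>y i j\<bar> \<le> 1" for i j
      using law_bounds by (simp_all add: x_def y_def abs_le_iff add_nonneg_nonneg order_trans[of _ 0 1])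
    show "\<bar>x i j - y i j\<bar> \<le> window_prob i" for i j
      using law_increment_le[OF m_less[of i]] law_mono[OF m_less[of i]] by (simp add: x_def y_def)
    show "((\<lambda>i. (x i j - y i j) / window_prob i) \<longlongrightarrow> \<delta> j) F" for j
      unfolding x_def y_def \<delta>_def by (rule IH) (simp add: child_depth_def)
  qed (simp_all add: xa ya)
  moreover have "(\<Sum>k. if R k then pmf p k * (\<Sum>j=1..k. \<Prod>l=1..k. if l = j then \<delta> l else a l) else 0) =
      typed_law p True w (Suc d) t0 - (if same_root w t0 \<infinity> then (1 - \<mu>) * (\<Prod>j=1..w. a j) else 0)"
  proof -
    have "(\<lambda>k. if R k then pmf p k * (\<Sum>j=1..k. \<Prod>l=1..k. typed_law p (l = j) w (child_depth w d l) (subtree_at l t0)) else 0)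
      sums (typed_law p True w (Suc d) t0 - (if same_root w t0 \<infinity> then (1 - \<mu>) * (\<Prod>j=1..w. a j) else 0))"
      unfolding R_def \<mu>_def a_def using subcritical by (intro special_law_Suc) simp
    moreover have "typed_law p (l = j) w (child_depth w d l) (subtree_at l t0) = (if l = j then \<delta> l else a l)" for l j
      by (simp add: \<delta>_def a_def)
    ultimately show ?thesis by (simp only: sums_unique[symmetric])
  qed
  ultimately have head: "(head \<longlongrightarrow> typed_law p True w (Suc d) t0 - (if same_root w t0 \<infinity> then (1 - \<mu>) * (\<Prod>j=1..w. a j) else 0)) F"
    by simp
  have tail: "(tail \<longlongrightarrow> (if same_root w t0 \<infinity> then (1 - \<mu>) * (\<Prod>j=1..w. a j) else 0)) F"
  proof (cases "same_root w t0 \<infinity>")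
    case True
    have "((\<lambda>i. (\<Prod>j=1..w. x i j) / max_cdf (m' i) ^ w * (root_in_window i / window_prob i)) \<longlongrightarrow> (\<Prod>j=1..w. a j) / 1 ^ w * (1 - \<mu>)) F"
      unfolding \<mu>_def by (intro tendsto_mult tendsto_divide tendsto_prod tendsto_power xa max_cdf_upper_tendsto root_in_window_tendsto) auto
    moreover have "tail = (\<lambda>i. (\<Prod>j=1..w. x i j) / max_cdf (m' i) ^ w * (root_in_window i / window_prob i))"
      using True by (simp add: fun_eq_iff tail_def)
    ultimately show ?thesis using True by (simp add: mult.commute)
  next
    case False
    then have "tail = (\<lambda>_. 0)" by (simp add: fun_eq_iff tail_def)
    then show ?thesis using False by simp
  qed
  have "\<forall>\<^sub>F i in F. w \<le> m i" using m_lim by (simp add: filterlim_at_top)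
  moreover have "\<forall>\<^sub>F i in F. 0 < max_cdf (m' i)" using max_cdf_upper_tendsto by (rule order_tendstoD(1)) simp
  ultimately have "\<forall>\<^sub>F i in F. head i + tail i = (law (m' i) w (Suc d) t0 - law (enat (m i)) w (Suc d) t0) / window_prob i"
    using window_prob_pos
  proof eventually_elim
    case (elim i)
    let ?h = "\<lambda>k. if R k \<and> k \<le> m i then pmf p k * ((\<Prod>j=1..k. x i j) - (\<Prod>j=1..k. y i j)) else 0"
    let ?r = "\<lambda>k. if m i < k \<and> enat k \<le> m' i then pmf p k * max_cdf (m' i) ^ k else 0"
    let ?C = "if same_root w t0 \<infinity> then (\<Prod>j=1..w. x i j) / max_cdf (m' i) ^ w else 0"
    \<comment> \<open>Only the first \<open>w\<close> of the \<open>k\<close> children are visible; each of the others contributes the factor \<open>P(M \<le> m')\<close>, so that the cylinder enters the series as a constant factor.\<close>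
    have large: "(if R k \<and> m i < k \<and> enat k \<le> m' i then pmf p k * (\<Prod>j=1..k. x i j) else 0) = ?C * ?r k" for k
    proof (cases "m i < k \<and> enat k \<le> m' i")
      case True
      then have wk: "w < k" using elim(1) by simp
      have R: "R k \<longleftrightarrow> same_root w t0 \<infinity>"
        using wk by (simp add: R_def same_root_def min_def)
      have "(\<Prod>j=1..k. x i j) = (\<Prod>j=1..w. x i j) * (\<Prod>j=Suc w..k. x i j)"
      proof -
        have "{1..k} = {1..w} \<union> {Suc w..k}" using wk by auto
        then show ?thesis by (simp only:) (rule prod.union_disjoint, auto)
      qed
      also have "(\<Prod>j=Suc w..k. x i j) = (\<Prod>j=Suc w..k. max_cdf (m' i))"
        by (intro prod.cong refl) (simp add: x_def child_depth_def bounded_law_0)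
      also have "\<dots> = max_cdf (m' i) ^ k / max_cdf (m' i) ^ w"
        using wk elim(2) by (simp add: power_diff)
      finally show ?thesis using True R by simp
    qed auto
    have "(\<lambda>k. ?h k + (if R k \<and> m i < k \<and> enat k \<le> m' i then pmf p k * (\<Prod>j=1..k. x i j) else 0))
      sums (law (m' i) w (Suc d) t0 - law (enat (m i)) w (Suc d) t0)"
      using increment_split[of w t0 i d] by (simp only: x_def y_def R_def)
    then have "(\<lambda>k. ?h k + ?C * ?r k) sums (law (m' i) w (Suc d) t0 - law (enat (m i)) w (Suc d) t0)"
      by (simp only: large)
    moreover have "(\<lambda>k. ?h k + ?C * ?r k) sums (suminf ?h + ?C * root_in_window i)"
      using summable_truncated[of R i] sums_summable[OF root_in_window_sums[of i]]
      by (intro sums_add sums_mult summable_sums)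
    ultimately have "law (m' i) w (Suc d) t0 - law (enat (m i)) w (Suc d) t0 = suminf ?h + ?C * root_in_window i"
      by (rule sums_unique2)
    moreover have "head i = suminf ?h / window_prob i"
    proof -
      have "head i = (\<Sum>k. ?h k / window_prob i)" unfolding head_def by (intro suminf_cong) simp
      also have "\<dots> = suminf ?h / window_prob i" by (rule suminf_divide[OF summable_truncated])
      finally show ?thesis .
    qed
    ultimately show ?case by (simp add: tail_def add_divide_distrib)
  qed
  moreover have "((\<lambda>i. head i + tail i) \<longlongrightarrow> typed_law p True w (Suc d) t0) F"
    using tendsto_add[OF head tail] by simp
  ultimately show ?thesis by (rule Lim_transform_eventually[rotated])
qed

lemma increment_ratio_tendsto:
  "((\<lambda>i. (law (m' i) w d t0 - law (enat (m i)) w d t0) / window_prob i) \<longlongrightarrow> typed_law p True w d t0) F"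
proof -
  have zero: "((\<lambda>i. (law (m' i) w 0 t0 - law (enat (m i)) w 0 t0) / window_prob i) \<longlongrightarrow> typed_law p True w 0 t0) F" for t0
    unfolding typed_law_0
    by (rule Lim_transform_eventually[OF tendsto_const])
       (use window_prob_pos in \<open>eventually_elim, simp add: bounded_law_0\<close>)
  show ?thesis
  proof (induction d arbitrary: t0)
    case (Suc d)
    show ?case by (rule increment_ratio_step) (use zero Suc.IH in auto)
  qed (rule zero)
qed

lemma size_biased_tree_cylinder:
  "measure (size_biased_tree p) {t. trunc w d t = trunc w d t0} = typed_law p True w d t0"
proof -
  have "{t. trunc w d t = trunc w d t0} \<in> sets borel"
    using trunc_measurable[of w d "trunc w d t0"] by (simp add: pred_def)
  then show ?thesis
    unfolding size_biased_tree_def grown_tree_eq typed_law_def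
    by (subst measure_distr[OF typed_tree_measurable]) (auto intro!: arg_cong2[where f=measure])
qed

theorem weakly_converges_conditioned:
  assumes A: "\<forall>\<^sub>F i in F. A i = {\<omega>\<in>space M. enat (m i) < max_outdegree (\<tau> \<omega>) \<and> max_outdegree (\<tau> \<omega>) \<le> m' i}"
  shows "weakly_converges (\<lambda>i. cond_dist M \<tau> (A i)) (size_biased_tree p) F"
proof (rule weakly_converges_treeI)
  let ?A = "\<lambda>i. {\<omega>\<in>space M. enat (m i) < max_outdegree (\<tau> \<omega>) \<and> max_outdegree (\<tau> \<omega>) \<le> m' i}"
  have A_sets: "?A i \<in> sets M" for i
  proof -
    have "?A i = {\<omega>\<in>space M. max_outdegree (\<tau> \<omega>) \<le> m' i} - {\<omega>\<in>space M. max_outdegree (\<tau> \<omega>) \<le> enat (m i)}"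
      by auto
    also have "\<dots> \<in> sets M" by measurable
    finally show ?thesis .
  qed
  have A_prob: "prob (?A i) = window_prob i" for i
    using law_increment[OF m_less[of i], of undefined 0 undefined] by (simp add: bounded_law_0)
  have unif: "prob_space (uniform_measure M (?A i))" if "0 < window_prob i" for i
    using that A_prob[of i] by (intro prob_space_uniform_measure) (auto simp: emeasure_eq_measure)
  have meas: "\<tau> \<in> uniform_measure M B \<rightarrow>\<^sub>M borel" for B
    using tau_measurable by (simp cong: measurable_cong_sets)
  show "\<forall>\<^sub>F i in F. prob_space (cond_dist M \<tau> (A i)) \<and> sets (cond_dist M \<tau> (A i)) = sets borel"
    using A window_prob_pos
  proof eventually_elim
    case (elim i)
    show ?case unfolding cond_dist_def elim(1)
      using prob_space.prob_space_distr[OF unif[OF elim(2)] meas] by simp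
  qed
  show "prob_space (size_biased_tree p)"
    unfolding size_biased_tree_def grown_tree_eq
    by (intro prob_space.prob_space_distr prob_space_PiM typed_tree_measurable measure_pmf.prob_space_axioms)
  show "sets (size_biased_tree p) = sets borel"
    by (simp add: size_biased_tree_def)
  fix h t0
  have "\<forall>\<^sub>F i in F. (law (m' i) h h t0 - law (enat (m i)) h h t0) / window_prob i =
      measure (cond_dist M \<tau> (A i)) {t. restr h t = restr h t0}"
    using A window_prob_pos
  proof eventually_elim
    case (elim i)
    let ?E = "{\<omega>\<in>space M. trunc h h (\<tau> \<omega>) = trunc h h t0}"
    have "{t. trunc h h t = trunc h h t0} \<in> sets borel"
      using trunc_measurable[of h h "trunc h h t0"] by (simp add: pred_def)
    then have "measure (cond_dist M \<tau> (A i)) {t. restr h t = restr h t0} = measure (uniform_measure M (?A i)) ?E"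
      unfolding cond_dist_def elim(1) restr_eq_trunc
      by (subst measure_distr[OF meas]) (auto intro!: arg_cong2[where f=measure])
    also have "\<dots> = prob (?A i \<inter> ?E) / prob (?A i)"
    proof (rule measure_uniform_measure)
      show "?E \<in> sets M" by measurable
      show "emeasure M (?A i) \<noteq> 0" using elim(2) A_prob[of i] by (auto simp: emeasure_eq_measure)
    qed (simp add: emeasure_eq_measure)
    also have "?A i \<inter> ?E = {\<omega>\<in>space M. trunc h h (\<tau> \<omega>) = trunc h h t0 \<and>
       enat (m i) < max_outdegree (\<tau> \<omega>) \<and> max_outdegree (\<tau> \<omega>) \<le> m' i}" by auto
    finally show ?case by (simp add: A_prob law_increment[OF m_less])
  qed
  with increment_ratio_tendsto[of h h t0]
  show "((\<lambda>i. measure (cond_dist M \<tau> (A i)) {t. restr h t = restr h t0}) \<longlongrightarrow>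
      measure (size_biased_tree p) {t. restr h t = restr h t0}) F"
    unfolding restr_eq_trunc size_biased_tree_cylinder by (rule Lim_transform_eventually)
qed

end
end

section \<open>The two conditionings\<close>

theorem theorem4p5:
  fixes p :: "nat pmf" and M :: "'a measure" and \<tau> :: "'a \<Rightarrow> ulam_tree"
  assumes subcritical: "offspring_mean p < 1"
    and unbounded: "\<not> bdd_above {n. pmf p n > 0}"
    and gw: "galton_watson M \<tau> p"
  shows "weakly_converges
           (\<lambda>n. cond_dist M \<tau> {\<omega>\<in>space M. max_outdegree (\<tau> \<omega>) = enat n})
           (size_biased_tree p)
           (inf sequentially (principal {n. pmf p n > 0})) \<and>
         weakly_converges
           (\<lambda>n. cond_dist M \<tau> {\<omega>\<in>space M. max_outdegree (\<tau> \<omega>) > enat n})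
           (size_biased_tree p)
           sequentially"
proof
  have large: "\<exists>k>n. 0 < pmf p k" for n
    using unbounded unfolding bdd_above_def by (metis mem_Collect_eq not_le)
  let ?F = "inf sequentially (principal {n. pmf p n > 0})"
  have "?F \<noteq> bot"
    using large by (auto simp: trivial_limit_def eventually_inf_principal eventually_sequentially not_le)
       (meson less_imp_le)
  moreover have "filterlim (\<lambda>n. n - 1) at_top ?F"
    by (rule filterlim_mono[OF filterlim_minus_const_nat_at_top order_refl inf_le1])
  moreover have pos: "\<forall>\<^sub>F n in ?F. 1 \<le> n"
    by (rule filter_leD[OF inf_le1 eventually_ge_at_top])
  then have "\<forall>\<^sub>F n in ?F. \<exists>k. n - 1 < k \<and> enat k \<le> enat n \<and> 0 < pmf p k"
  proof -
    have "\<forall>\<^sub>F n in ?F. 0 < pmf p n" by (simp add: eventually_inf_principal)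
    with pos show ?thesis by eventually_elim (intro exI, auto)
  qed
  moreover have "\<forall>\<^sub>F n in ?F. {\<omega>\<in>space M. max_outdegree (\<tau> \<omega>) = enat n} =
     {\<omega>\<in>space M. enat (n - 1) < max_outdegree (\<tau> \<omega>) \<and> max_outdegree (\<tau> \<omega>) \<le> enat n}"
    using pos
  proof eventually_elim
    case (elim n)
    have "x = enat n \<longleftrightarrow> enat (n - 1) < x \<and> x \<le> enat n" for x
      using elim by (cases x) auto
    then show ?case by blast
  qed
  ultimately show "weakly_converges (\<lambda>n. cond_dist M \<tau> {\<omega>\<in>space M. max_outdegree (\<tau> \<omega>) = enat n})
           (size_biased_tree p) ?F"
    by (intro weakly_converges_conditioned[OF subcritical gw, where m="\<lambda>n. n - 1" and m'=enat]) auto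
  show "weakly_converges (\<lambda>n. cond_dist M \<tau> {\<omega>\<in>space M. max_outdegree (\<tau> \<omega>) > enat n})
           (size_biased_tree p) sequentially"
    using large by (intro weakly_converges_conditioned[OF subcritical gw, where m="\<lambda>n. n" and m'="\<lambda>_. \<infinity>"])
      (auto simp: filterlim_ident)
qed

end
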